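(* Let $W_{\psi,\varphi}$ be an unbounded weighted composition operator on $\mathcal F^2$ induced by entire functions $\varphi,\psi$ with $\psi\not\equiv0$. The following assertions are equivalent. (1) The operator $W_{\psi,\varphi}$ is cohyponormal. (2) The operator $W_{\psi,\varphi}$ satisfies both: (a) $W_{\psi,\varphi}=W_{\psi,\varphi,\max}$; (b) one of the following cases occurs, for some complex constants $A,B,C,D$: (i) $\varphi(z)=Az+B$ with $A\ne1$, and $\psi(z)=Ce^{Dz}$, where $D=\overline B(1-A)(1-\overline A)^{-1}$; (ii) $\varphi(z)=z+B$, and $\psi(z)=Ce^{Dz}$, where $|B|\ge|D|$.
   Context: The Fock space $\mathcal F^2$ is the Hilbert space of entire functions on $\mathbb C$ that are square integrable with respect to $\frac1\pi e^{-|z|^2}\,dV(z)$ ($dV$ is Lebesgue measure on $\mathbb C$), with inner product $\langle f,g\rangle=\frac1\pi\int_{\mathbb C}f(z)\overline{g(z)}e^{-|z|^2}\,dV(z)$. For entire functions $\psi,\varphi$, put $E(\psi,\varphi)f=\psi\cdot (f\circ\varphi)$. The maximal weighted composition operator $W_{\psi,\varphi,\max}$ has domain $\{f\in\mathcal F^2: E(\psi,\varphi)f\in\mathcal F^2\}$ and acts by $W_{\psi,\varphi,\max}f=E(\psi,\varphi)f$. An unbounded weighted composition operator $W_{\psi,\varphi}$ is the restriction of $W_{\psi,\varphi,\max}$ to some linear subspace $\operatorname{dom}(W_{\psi,\varphi})$ of $\operatorname{dom}(W_{\psi,\varphi,\max})$ ("unbounded" means not necessarily bounded). An operator $T$ is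 cohyponormal if it is closed, densely defined, $\operatorname{dom}(T^* )\subseteq\operatorname{dom}(T)$ and $\|T^*x\|\ge\|Tx\|$ for all $x\in\operatorname{dom}(T^* )$. *)

theory Defs
  imports "HOL-Complex_Analysis.Complex_Analysis"
begin

definition fock_measure :: "complex measure" where
  "fock_measure = density lborel (\<lambda>z. ennreal (1 / pi * exp (- (cmod z)\<^sup>2)))"

definition fock_space :: "(complex \<Rightarrow> complex) set" where
  "fock_space = {f. f holomorphic_on UNIV \<and> integrable fock_measure (\<lambda>z. (cmod (f z))\<^sup>2)}"

definition fock_inner :: "(complex \<Rightarrow> complex) \<Rightarrow> (complex \<Rightarrow> complex) \<Rightarrow> complex" where
  "fock_inner f g = (LINT z|fock_measure. f z * cnj (g z))"

definition fock_norm :: "(complex \<Rightarrow> complex) \<Rightarrow> real" where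
  "fock_norm f = sqrt (Re (fock_inner f f))"

definition fun_subspace :: "(complex \<Rightarrow> complex) set \<Rightarrow> bool" where
  "fun_subspace S \<longleftrightarrow> (\<lambda>z. 0) \<in> S \<and>
     (\<forall>f\<in>S. \<forall>g\<in>S. (\<lambda>z. f z + g z) \<in> S) \<and>
     (\<forall>c. \<forall>f\<in>S. (\<lambda>z. c * f z) \<in> S)"

text \<open>
  Operators are partial maps, so equality of operators includes equality of their domains.
  Elements of the Fock space are genuine entire functions, not classes modulo null sets.
\<close>

type_synonym fock_op = "(complex \<Rightarrow> complex) \<rightharpoonup> (complex \<Rightarrow> complex)"

definition densely_defined :: "fock_op \<Rightarrow> bool" where
  "densely_defined T \<longleftrightarrow>
     (\<forall>f\<in>fock_space. \<forall>\<epsilon>>0. \<exists>g\<in>dom T. fock_norm (\<lambda>z. f z - g z) < \<epsilon>)"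

definition closed_op :: "fock_op \<Rightarrow> bool" where
  "closed_op T \<longleftrightarrow>
     (\<forall>X. \<forall>f\<in>fock_space. \<forall>g\<in>fock_space.
        (\<forall>n::nat. X n \<in> dom T) \<longrightarrow>
        (\<lambda>n. fock_norm (\<lambda>z. X n z - f z)) \<longlonglongrightarrow> 0 \<longrightarrow>
        (\<lambda>n. fock_norm (\<lambda>z. the (T (X n)) z - g z)) \<longlonglongrightarrow> 0 \<longrightarrow>
        T f = Some g)"

definition adjoint_rel :: "fock_op \<Rightarrow> (complex \<Rightarrow> complex) \<Rightarrow> (complex \<Rightarrow> complex) \<Rightarrow> bool" where
  "adjoint_rel T g h \<longleftrightarrow> g \<in> fock_space \<and> h \<in> fock_space \<and>
     (\<forall>f\<in>dom T. fock_inner (the (T f)) g = fock_inner f h)"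

text \<open>
  The value below is meaningful only for densely defined \<open>T\<close>, in which case \<open>h\<close> is unique.
\<close>

definition adjoint_op :: "fock_op \<Rightarrow> fock_op" where
  "adjoint_op T = (\<lambda>g. if \<exists>h. adjoint_rel T g h then Some (THE h. adjoint_rel T g h) else None)"

definition cohyponormal :: "fock_op \<Rightarrow> bool" where
  "cohyponormal T \<longleftrightarrow> closed_op T \<and> densely_defined T \<and> dom (adjoint_op T) \<subseteq> dom T \<and>
     (\<forall>f\<in>dom (adjoint_op T). fock_norm (the (adjoint_op T f)) \<ge> fock_norm (the (T f)))"

definition weighted_comp ::
    "(complex \<Rightarrow> complex) \<Rightarrow> (complex \<Rightarrow> complex) \<Rightarrow> (complex \<Rightarrow> complex) \<Rightarrow> (complex \<Rightarrow> complex)" where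
  "weighted_comp \<psi> \<phi> f = (\<lambda>z. \<psi> z * f (\<phi> z))"

definition weighted_comp_max :: "(complex \<Rightarrow> complex) \<Rightarrow> (complex \<Rightarrow> complex) \<Rightarrow> fock_op" where
  "weighted_comp_max \<psi> \<phi> =
     (\<lambda>f. if f \<in> fock_space \<and> weighted_comp \<psi> \<phi> f \<in> fock_space
          then Some (weighted_comp \<psi> \<phi> f) else None)"

definition is_weighted_comp_op ::
    "(complex \<Rightarrow> complex) \<Rightarrow> (complex \<Rightarrow> complex) \<Rightarrow> fock_op \<Rightarrow> bool" where
  "is_weighted_comp_op \<psi> \<phi> W \<longleftrightarrow>
     (\<exists>S. fun_subspace S \<and> S \<subseteq> dom (weighted_comp_max \<psi> \<phi>) \<and> W = weighted_comp_max \<psi> \<phi> |` S)"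

end

theory Submission
  imports Defs "HOL-Probability.Distributions" "HOL-Real_Asymp.Real_Asymp"
begin

text \<open>
  The adjoint maps the reproducing kernel \<open>K\<^sub>w\<close> to \<open>cnj (\<psi> w) K\<^sub>\<phi>\<^sub>(\<^sub>w\<^sub>)\<close>, so cohyponormality puts \<open>K\<^sub>w\<close> into
  the domain and bounds \<open>\<psi> z exp (\<phi> z cnj w)\<close> by \<open>|\<psi> w| exp ((|\<phi> w|\<^sup>2 + |z|\<^sup>2) / 2)\<close>. Hence \<open>\<psi>\<close> has no
  zeros. If \<open>\<phi> w = \<phi> w'\<close>, a combination of \<open>K\<^sub>w\<close> and \<open>K\<^sub>w\<^sub>'\<close> is annihilated by the adjoint and thus by
  the operator, which forces \<open>\<phi>\<close> to be constant or injective, hence affine, \<open>\<phi> z = A z + B\<close>. Putting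
  \<open>z = cnj A w + k\<close> in the bound cancels all quadratic terms, and Liouville's theorem yields a
  functional equation for \<open>\<psi>\<close> whose solutions are \<open>C exp (D z)\<close> with \<open>D (1 - cnj A) = cnj B (1 - A)\<close>.

  For such symbols the formal adjoint is \<open>H f z = cnj C exp (cnj B z) f (cnj A z + cnj D)\<close>. An affine
  substitution with unimodular linear part shows that \<open>W f\<close> and \<open>H f\<close> have proportional norms, with factor at
  least one exactly when \<open>|D| \<le> |B|\<close>. Moreover \<open>\<langle>W g, f\<rangle> = \<langle>g, H f\<rangle>\<close> on the maximal domains: by Fubini
  and the reproducing formula if \<open>|A| < 1\<close>, by passing to inverses if \<open>|A| > 1\<close>, and by dilating \<open>f\<close>
  if \<open>|A| = 1\<close>. So the maximal domain of a cohyponormal \<open>W\<close> lies in the domain of the adjoint of \<open>W\<close>, which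
  lies in the domain of \<open>W\<close>; this gives maximality without any double adjoint.
\<close>

section \<open>Lebesgue measure on the complex plane\<close>

text \<open>Lebesgue measure is determined by its values on boxes, and pairing real and imaginary
  parts carries boxes to boxes. This opens the way to Fubini in the coordinates.\<close>

lemma distr_lborel_Complex:
  "distr (lborel :: (real \<times> real) measure) borel (\<lambda>p. Complex (fst p) (snd p)) = lborel"
proof (rule lborel_eqI[symmetric])
  fix l u :: complex
  assume le: "\<And>b. b \<in> Basis \<Longrightarrow> l \<bullet> b \<le> u \<bullet> b"
  have meas: "(\<lambda>p. Complex (fst p) (snd p)) \<in> borel_measurable (lborel :: (real \<times> real) measure)"
    by (simp add: borel_measurable_continuous_onI continuous_on_Complex continuous_on_fst continuous_on_snd continuous_on_id)
  have vimage: "(\<lambda>p. Complex (fst p) (snd p)) -` box l u = box (Re l, Im l) (Re u, Im u)"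
    by (auto simp: box_def Basis_complex_def Basis_prod_def inner_complex_def)
  have "l \<bullet> 1 \<le> u \<bullet> 1" "l \<bullet> \<i> \<le> u \<bullet> \<i>"
    by (rule le; simp add: Basis_complex_def)+
  then have "Re l \<le> Re u" "Im l \<le> Im u"
    by (auto simp: inner_complex_def)
  then show "emeasure (distr lborel borel (\<lambda>p. Complex (fst p) (snd p))) (box l u)
      = ennreal (\<Prod>b\<in>Basis. (u - l) \<bullet> b)"
    using meas
    by (simp add: emeasure_distr vimage emeasure_lborel_box_eq Basis_complex_def Basis_prod_def
        inner_complex_def complex_eq_iff prod.union_disjoint)
qed simp

lemma nn_integral_lborel_complex:
  assumes [measurable]: "f \<in> borel_measurable (borel :: complex measure)"
  shows "(\<integral>\<^sup>+z. f z \<partial>lborel) = (\<integral>\<^sup>+y. \<integral>\<^sup>+x. f (Complex x y) \<partial>lborel \<partial>lborel)"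
    and "(\<integral>\<^sup>+z. f z \<partial>lborel) = (\<integral>\<^sup>+x. \<integral>\<^sup>+y. f (Complex x y) \<partial>lborel \<partial>lborel)"
proof -
  have [measurable]: "(\<lambda>p. Complex (fst p) (snd p)) \<in> borel_measurable (borel :: (real \<times> real) measure)"
    by (simp add: borel_measurable_continuous_onI continuous_on_Complex continuous_on_fst continuous_on_snd continuous_on_id)
  have eq: "(\<integral>\<^sup>+z. f z \<partial>lborel) = (\<integral>\<^sup>+p. f (Complex (fst p) (snd p)) \<partial>(lborel \<Otimes>\<^sub>M lborel))"
    unfolding lborel_prod by (subst distr_lborel_Complex[symmetric]) (simp add: nn_integral_distr)
  have [measurable]: "(\<lambda>p. f (Complex (fst p) (snd p))) \<in> borel_measurable (lborel \<Otimes>\<^sub>M lborel)"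
    unfolding lborel_prod by simp
  show "(\<integral>\<^sup>+z. f z \<partial>lborel) = (\<integral>\<^sup>+x. \<integral>\<^sup>+y. f (Complex x y) \<partial>lborel \<partial>lborel)"
    unfolding eq by (subst lborel.nn_integral_fst[symmetric]) auto
  show "(\<integral>\<^sup>+z. f z \<partial>lborel) = (\<integral>\<^sup>+y. \<integral>\<^sup>+x. f (Complex x y) \<partial>lborel \<partial>lborel)"
    unfolding eq by (subst lborel_pair.nn_integral_snd[symmetric]) (auto simp: case_prod_unfold)
qed

text \<open>On each line along which the unsheared coordinate is fixed, a shear is a translation, so
  Fubini reduces the claim to the real line.\<close>

lemma nn_integral_lborel_shear:
  assumes [measurable]: "f \<in> borel_measurable (borel :: complex measure)"
  shows "(\<integral>\<^sup>+z. f (z + of_real (t * Im z)) \<partial>lborel) = (\<integral>\<^sup>+z. f z \<partial>lborel)"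
    and "(\<integral>\<^sup>+z. f (z + \<i> * of_real (t * Re z)) \<partial>lborel) = (\<integral>\<^sup>+z. f z \<partial>lborel)"
proof -
  have [measurable]: "(\<lambda>x. Complex x y) \<in> borel_measurable borel" "(\<lambda>x. Complex y x) \<in> borel_measurable borel" for y
    by (simp_all add: borel_measurable_continuous_onI continuous_on_Complex)
  have 1: "(\<integral>\<^sup>+x. f (Complex x y + of_real (t * y)) \<partial>lborel) = (\<integral>\<^sup>+x. f (Complex x y) \<partial>lborel)" for y
  proof -
    have "Complex x y + of_real (t * y) = Complex (t * y + 1 * x) y" for x
      by (simp add: complex_eq_iff)
    then show ?thesis
      using nn_integral_real_affine[of "\<lambda>x. f (Complex x y)" 1 "t * y"] by simp
  qed
  have 2: "(\<integral>\<^sup>+y. f (Complex x y + \<i> * of_real (t * x)) \<partial>lborel) = (\<integral>\<^sup>+y. f (Complex x y) \<partial>lborel)" for x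
  proof -
    have "Complex x y + \<i> * of_real (t * x) = Complex x (t * x + 1 * y)" for y
      by (simp add: complex_eq_iff)
    then show ?thesis
      using nn_integral_real_affine[of "\<lambda>y. f (Complex x y)" 1 "t * x"] by simp
  qed
  show "(\<integral>\<^sup>+z. f (z + of_real (t * Im z)) \<partial>lborel) = (\<integral>\<^sup>+z. f z \<partial>lborel)"
    by (subst (1 2) nn_integral_lborel_complex(1)) (simp_all add: 1[simplified])
  show "(\<integral>\<^sup>+z. f (z + \<i> * of_real (t * Re z)) \<partial>lborel) = (\<integral>\<^sup>+z. f z \<partial>lborel)"
    by (subst (1 2) nn_integral_lborel_complex(2)) (simp_all add: 2[simplified])
qed

lemma nn_integral_lborel_rotate:
  assumes [measurable]: "f \<in> borel_measurable (borel :: complex measure)" and "cmod \<tau> = 1"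
  shows "(\<integral>\<^sup>+z. f (\<tau> * z) \<partial>lborel) = (\<integral>\<^sup>+z. f z \<partial>lborel)"
proof -
  \<comment> \<open>A rotation by an angle less than \<open>\<pi>\<close> is a product of three shears; any rotation is the square of one with \<open>Re \<sigma> \<ge> 0\<close>.\<close>
  have small: "(\<integral>\<^sup>+z. g (\<sigma> * z) \<partial>lborel) = (\<integral>\<^sup>+z. g z \<partial>lborel)"
    if [measurable]: "g \<in> borel_measurable (borel :: complex measure)"
      and s: "cmod \<sigma> = 1" "Re \<sigma> \<ge> 0" for g \<sigma>
  proof -
    \<comment> \<open>\<open>t\<close> is minus the tangent of half the rotation angle. It exists
      because \<open>Re \<sigma> \<ge> 0\<close> excludes the angle \<pi>.\<close>
    define t where "t = - Im \<sigma> / (1 + Re \<sigma>)"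
    have sq: "(Re \<sigma>)\<^sup>2 + (Im \<sigma>)\<^sup>2 = 1"
      using s(1) by (simp add: cmod_def)
    have ne: "1 + Re \<sigma> \<noteq> 0" using s by linarith
    have ta: "1 + t * Im \<sigma> = Re \<sigma>"
      using ne sq by (simp add: t_def field_simps power2_eq_square)
    have tb: "t * (1 + Re \<sigma>) = - Im \<sigma>"
      using ne by (simp add: t_def)
    define h1 where "h1 z = z + of_real (t * Im z)" for z
    define h2 where "h2 z = z + \<i> * of_real (Im \<sigma> * Re z)" for z
    have [measurable]: "h1 \<in> borel_measurable borel" "h2 \<in> borel_measurable borel"
      unfolding h1_def h2_def by measurable
    have "\<sigma> * z = h1 (h2 (h1 z))" for z
    proof -
      have "Im (\<sigma> * z) = Im z * (1 + t * Im \<sigma>) + Im \<sigma> * Re z"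
        unfolding ta by (simp add: algebra_simps)
      also have "\<dots> = Im (h1 (h2 (h1 z)))"
        by (simp add: h1_def h2_def algebra_simps)
      finally have im: "Im (\<sigma> * z) = Im (h1 (h2 (h1 z)))" .
      have "Re (\<sigma> * z) = Re \<sigma> * Re z + Im z * (t * (1 + Re \<sigma>))"
        unfolding tb by (simp add: algebra_simps)
      also have "\<dots> = (1 + t * Im \<sigma>) * Re z + Im z * t * (1 + (1 + t * Im \<sigma>))"
        unfolding ta by (simp add: algebra_simps)
      also have "\<dots> = Re (h1 (h2 (h1 z)))"
        by (simp add: h1_def h2_def algebra_simps)
      finally show ?thesis using im by (simp add: complex_eq_iff)
    qed
    then have "(\<integral>\<^sup>+z. g (\<sigma> * z) \<partial>lborel) = (\<integral>\<^sup>+z. g (h1 (h2 (h1 z))) \<partial>lborel)"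
      by simp
    also have "\<dots> = (\<integral>\<^sup>+z. g (h1 (h2 z)) \<partial>lborel)"
      using nn_integral_lborel_shear(1)[of "\<lambda>z. g (h1 (h2 z))" t] by (simp add: h1_def)
    also have "\<dots> = (\<integral>\<^sup>+z. g (h1 z) \<partial>lborel)"
      using nn_integral_lborel_shear(2)[of "\<lambda>z. g (h1 z)" "Im \<sigma>"] by (simp add: h2_def)
    also have "\<dots> = (\<integral>\<^sup>+z. g z \<partial>lborel)"
      using nn_integral_lborel_shear(1)[of g t] by (simp add: h1_def)
    finally show ?thesis .
  qed
  define \<sigma> where "\<sigma> = csqrt \<tau>"
  have sig: "cmod \<sigma> = 1" "Re \<sigma> \<ge> 0" "\<sigma> * \<sigma> = \<tau>"
    using assms(2) power2_csqrt[of \<tau>] abs_Re_le_cmod[of \<tau>] by (simp_all add: \<sigma>_def power2_eq_square norm_csqrt csqrt_principal Re_csqrt)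
  have "(\<integral>\<^sup>+z. f (\<tau> * z) \<partial>lborel) = (\<integral>\<^sup>+z. f (\<sigma> * (\<sigma> * z)) \<partial>lborel)"
    by (simp flip: sig(3) add: mult.assoc)
  also have "\<dots> = (\<integral>\<^sup>+z. f (\<sigma> * z) \<partial>lborel)"
    using small[of "\<lambda>z. f (\<sigma> * z)" \<sigma>] sig by simp
  also have "\<dots> = (\<integral>\<^sup>+z. f z \<partial>lborel)"
    using small[of f \<sigma>] sig by simp
  finally show ?thesis .
qed

text \<open>The factorisation \<open>c = cmod c * \<tau>\<close> splits the map into a rotation and
  a real dilation with translation; the latter is \<open>lborel_affine\<close>, and the real
  dimension 2 gives the exponent of \<open>cmod c\<close>.\<close>

lemma lborel_complex_affine:
  fixes b c :: complex
  assumes "c \<noteq> 0"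
  shows "lborel = density (distr lborel borel (\<lambda>z. c * z + b)) (\<lambda>_. ennreal ((cmod c)\<^sup>2))"
proof (rule measure_eqI)
  fix A :: "complex set" assume "A \<in> sets lborel"
  then have [measurable]: "A \<in> sets borel" by simp
  define \<tau> where "\<tau> = sgn c"
  have \<tau>: "cmod \<tau> = 1" "c = cmod c * \<tau>"
    using assms by (simp_all add: \<tau>_def norm_sgn complex_sgn_def scaleR_conv_of_real norm_mult norm_inverse)
  let ?f = "\<lambda>z. indicator A z :: ennreal"
  have "emeasure lborel A = (\<integral>\<^sup>+z. ?f z \<partial>lborel)" by simp
  also have "\<dots> = (\<integral>\<^sup>+z. ennreal ((cmod c)\<^sup>2) * ?f (b + cmod c *\<^sub>R z) \<partial>lborel)"
    using assms
    by (subst lborel_affine[of "cmod c" b])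
      (simp_all add: nn_integral_density nn_integral_distr ennreal_power DIM_complex del: nn_integral_indicator)
  also have "\<dots> = (\<integral>\<^sup>+z. ennreal ((cmod c)\<^sup>2) * ?f (b + cmod c *\<^sub>R (\<tau> * z)) \<partial>lborel)"
    using nn_integral_lborel_rotate[of "\<lambda>z. ennreal ((cmod c)\<^sup>2) * ?f (b + cmod c *\<^sub>R z)" \<tau>] \<tau>(1) by simp
  also have "\<dots> = (\<integral>\<^sup>+z. ennreal ((cmod c)\<^sup>2) * ?f (c * z + b) \<partial>lborel)"
    using \<tau>(2) by (simp add: scaleR_conv_of_real add.commute mult.assoc[symmetric])
  also have "\<dots> = emeasure (density (distr lborel borel (\<lambda>z. c * z + b)) (\<lambda>_. ennreal ((cmod c)\<^sup>2))) A"
    by (simp add: emeasure_density nn_integral_distr)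
  finally show "emeasure lborel A = \<dots>" .
qed simp

lemma lborel_complex_affine_integral:
  fixes f :: "complex \<Rightarrow> 'a::{banach, second_countable_topology}"
  assumes [measurable]: "f \<in> borel_measurable borel" and c: "c \<noteq> 0"
  shows "integrable lborel (\<lambda>z. f (c * z + b)) \<longleftrightarrow> integrable lborel f"
    and "(\<integral>z. f z \<partial>lborel) = (cmod c)\<^sup>2 *\<^sub>R (\<integral>z. f (c * z + b) \<partial>lborel)"
proof -
  have "integrable lborel f \<longleftrightarrow>
      integrable (density (distr lborel borel (\<lambda>z. c * z + b)) (\<lambda>_. ennreal ((cmod c)\<^sup>2))) f"
    using lborel_complex_affine[OF c, of b] by simp
  then have "integrable lborel f \<longleftrightarrow> integrable lborel (\<lambda>z. (cmod c)\<^sup>2 *\<^sub>R f (c * z + b))"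
    by (simp add: integrable_density integrable_distr_eq c)
  also have "\<dots> \<longleftrightarrow> integrable lborel (\<lambda>z. f (c * z + b))"
  proof
    assume "integrable lborel (\<lambda>z. (cmod c)\<^sup>2 *\<^sub>R f (c * z + b))"
    then have "integrable lborel (\<lambda>z. inverse ((cmod c)\<^sup>2) *\<^sub>R (cmod c)\<^sup>2 *\<^sub>R f (c * z + b))"
      by (rule integrable_scaleR_right)
    then show "integrable lborel (\<lambda>z. f (c * z + b))" using c by simp
  qed auto
  finally show "integrable lborel (\<lambda>z. f (c * z + b)) \<longleftrightarrow> integrable lborel f" ..
  have "(\<integral>z. f z \<partial>lborel)
      = (\<integral>z. f z \<partial>density (distr lborel borel (\<lambda>z. c * z + b)) (\<lambda>_. ennreal ((cmod c)\<^sup>2)))"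
    using lborel_complex_affine[OF c, of b] by simp
  then show "(\<integral>z. f z \<partial>lborel) = (cmod c)\<^sup>2 *\<^sub>R (\<integral>z. f (c * z + b) \<partial>lborel)"
    by (simp add: integral_density integral_distr)
qed

lemma has_bochner_integral_exp_minus_square:
  "has_bochner_integral lborel (\<lambda>x. exp (- x\<^sup>2) :: real) (sqrt pi)"
  using has_bochner_integral_even_function[OF gaussian_moment_0] by simp

lemma nn_integral_exp_minus_cmod_square:
  "(\<integral>\<^sup>+z. ennreal (exp (- (cmod z)\<^sup>2)) \<partial>lborel) = ennreal pi"
proof -
  have 1: "(\<integral>\<^sup>+x. ennreal (exp (- x\<^sup>2)) \<partial>lborel) = ennreal (sqrt pi)"
    using has_bochner_integral_exp_minus_square
    by (subst nn_integral_eq_integral) (auto simp: has_bochner_integral_iff)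
  have "(\<integral>\<^sup>+z. ennreal (exp (- (cmod z)\<^sup>2)) \<partial>lborel)
      = (\<integral>\<^sup>+y. \<integral>\<^sup>+x. ennreal (exp (- y\<^sup>2)) * ennreal (exp (- x\<^sup>2)) \<partial>lborel \<partial>lborel)"
    by (subst nn_integral_lborel_complex(1))
      (simp_all add: cmod_power2 exp_add[symmetric] ennreal_mult[symmetric] algebra_simps)
  also have "\<dots> = ennreal (sqrt pi) * ennreal (sqrt pi)"
    by (simp add: nn_integral_cmult nn_integral_multc 1)
  finally show ?thesis
    by (simp add: ennreal_mult[symmetric])
qed

section \<open>The Fock space\<close>

lemma space_fock_measure [simp]: "space fock_measure = UNIV"
  by (simp add: fock_measure_def)

lemma sets_fock_measure [simp, measurable_cong]: "sets fock_measure = sets borel"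
  by (simp add: fock_measure_def)

lemma measurable_cnj [measurable]: "cnj \<in> borel_measurable borel"
  by (intro borel_measurable_continuous_onI continuous_intros)

lemma holomorphic_borel_measurable:
  "f holomorphic_on UNIV \<Longrightarrow> f \<in> borel_measurable borel"
  by (intro borel_measurable_continuous_onI holomorphic_on_imp_continuous_on)

lemma fock_integrable_iff:
  fixes f :: "complex \<Rightarrow> 'a::{banach, second_countable_topology}"
  assumes [measurable]: "f \<in> borel_measurable borel"
  shows "integrable fock_measure f \<longleftrightarrow> integrable lborel (\<lambda>z. (1 / pi * exp (- (cmod z)\<^sup>2)) *\<^sub>R f z)"
  unfolding fock_measure_def by (subst integrable_density) auto

lemma fock_integral_eq:
  fixes f :: "complex \<Rightarrow> 'a::{banach, second_countable_topology}"
  assumes [measurable]: "f \<in> borel_measurable borel"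
  shows "(\<integral>z. f z \<partial>fock_measure) = (\<integral>z. (1 / pi * exp (- (cmod z)\<^sup>2)) *\<^sub>R f z \<partial>lborel)"
  unfolding fock_measure_def by (subst integral_density) auto

text \<open>The exponential factor is the quotient of the Gaussian densities at
  \<open>c * z + b\<close> and at \<open>z\<close>. Keeping it explicit allows substitutions without
  leaving \<open>fock_measure\<close>.\<close>

lemma fock_change_of_variables:
  fixes f :: "complex \<Rightarrow> 'a::{banach, second_countable_topology}"
  assumes [measurable]: "f \<in> borel_measurable borel" and c: "c \<noteq> 0"
  shows "integrable fock_measure (\<lambda>z. exp ((cmod z)\<^sup>2 - (cmod (c * z + b))\<^sup>2) *\<^sub>R f (c * z + b))
           \<longleftrightarrow> integrable fock_measure f"
    and "(\<integral>z. f z \<partial>fock_measure)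
           = (cmod c)\<^sup>2 *\<^sub>R (\<integral>z. exp ((cmod z)\<^sup>2 - (cmod (c * z + b))\<^sup>2) *\<^sub>R f (c * z + b) \<partial>fock_measure)"
proof -
  let ?g = "\<lambda>z. (1 / pi * exp (- (cmod z)\<^sup>2)) *\<^sub>R f z"
  have eq: "(1 / pi * exp (- (cmod z)\<^sup>2)) *\<^sub>R exp ((cmod z)\<^sup>2 - (cmod (c * z + b))\<^sup>2) *\<^sub>R f (c * z + b)
      = ?g (c * z + b)" for z
    by (simp flip: exp_add)
  show "integrable fock_measure (\<lambda>z. exp ((cmod z)\<^sup>2 - (cmod (c * z + b))\<^sup>2) *\<^sub>R f (c * z + b))
           \<longleftrightarrow> integrable fock_measure f"
    using lborel_complex_affine_integral(1)[of ?g c b] c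
    by (subst (1 2) fock_integrable_iff) (simp_all only: eq, measurable)
  show "(\<integral>z. f z \<partial>fock_measure)
           = (cmod c)\<^sup>2 *\<^sub>R (\<integral>z. exp ((cmod z)\<^sup>2 - (cmod (c * z + b))\<^sup>2) *\<^sub>R f (c * z + b) \<partial>fock_measure)"
    using lborel_complex_affine_integral(2)[of ?g c b] c
    by (subst (1 2) fock_integral_eq) (simp_all only: eq, measurable)
qed

lemma fock_rotate:
  fixes f :: "complex \<Rightarrow> 'a::{banach, second_countable_topology}"
  assumes [measurable]: "f \<in> borel_measurable borel" and \<tau>: "cmod \<tau> = 1"
  shows "integrable fock_measure (\<lambda>z. f (\<tau> * z)) \<longleftrightarrow> integrable fock_measure f"
    and "(\<integral>z. f (\<tau> * z) \<partial>fock_measure) = (\<integral>z. f z \<partial>fock_measure)"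
proof -
  have "\<tau> \<noteq> 0" using \<tau> by auto
  then show "integrable fock_measure (\<lambda>z. f (\<tau> * z)) \<longleftrightarrow> integrable fock_measure f"
    and "(\<integral>z. f (\<tau> * z) \<partial>fock_measure) = (\<integral>z. f z \<partial>fock_measure)"
    using fock_change_of_variables[of f \<tau> 0] \<tau> by (simp_all add: norm_mult)
qed

lemma prob_space_fock_measure: "prob_space fock_measure"
proof
  have "emeasure fock_measure (space fock_measure)
      = (\<integral>\<^sup>+z. ennreal (1 / pi) * ennreal (exp (- (cmod z)\<^sup>2)) \<partial>lborel)"
    by (simp add: fock_measure_def emeasure_density flip: ennreal_mult)
  also have "\<dots> = 1"
    by (subst nn_integral_cmult)
      (simp_all add: nn_integral_exp_minus_cmod_square ennreal_mult[symmetric])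
  finally show "emeasure fock_measure (space fock_measure) = 1" .
qed

interpretation fock: prob_space fock_measure
  by (rule prob_space_fock_measure)

lemma fock_integrable_gaussian:
  assumes "\<epsilon> < 1"
  shows "integrable fock_measure (\<lambda>z. exp (\<epsilon> * (cmod z)\<^sup>2 + b * cmod z))"
proof -
  define \<delta> where "\<delta> = (1 + \<epsilon>) / 2"
  have \<delta>: "\<epsilon> < \<delta>" "\<delta> < 1" using assms by (auto simp: \<delta>_def)
  \<comment> \<open>Dilating the constant function 1 by \<open>s\<close> produces the integrable
    weight \<open>exp (\<delta> * (cmod z)\<^sup>2)\<close>. The gap between \<epsilon> and \<delta>
    absorbs the linear term.\<close>
  define s where "s = sqrt (1 - \<delta>)"
  have s: "s > 0" "s\<^sup>2 = 1 - \<delta>" using \<delta> by (auto simp: s_def)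
  have "integrable fock_measure (\<lambda>z. 1 :: real)"
    by simp
  then have "integrable fock_measure (\<lambda>z. exp ((cmod z)\<^sup>2 - (cmod (complex_of_real s * z + 0))\<^sup>2) *\<^sub>R (1::real))"
    using fock_change_of_variables(1)[of "\<lambda>z. 1 :: real" "complex_of_real s" 0] s(1) by simp
  moreover have "(cmod z)\<^sup>2 - (cmod (complex_of_real s * z + 0))\<^sup>2 = \<delta> * (cmod z)\<^sup>2" for z
    using s(1) by (simp add: norm_mult power_mult_distrib s(2) left_diff_distrib)
  ultimately have int: "integrable fock_measure (\<lambda>z. exp (\<delta> * (cmod z)\<^sup>2))"
    by simp
  \<comment> \<open>The maximum of \<open>b * x - (\<delta> - \<epsilon>) * x\<^sup>2\<close> over
    real \<open>x\<close>, found by completing the square.\<close>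
  define k where "k = b\<^sup>2 / (4 * (\<delta> - \<epsilon>))"
  have le: "exp (\<epsilon> * (cmod z)\<^sup>2 + b * cmod z) \<le> exp k * exp (\<delta> * (cmod z)\<^sup>2)" for z :: complex
  proof -
    define d where "d = \<delta> - \<epsilon>"
    define x where "x = cmod z"
    have d: "d > 0" using \<delta> by (simp add: d_def)
    have "0 \<le> (2 * d * x - b)\<^sup>2 / (4 * d)" using d by simp
    also have "\<dots> = d * x\<^sup>2 - b * x + k"
      using d by (simp add: k_def d_def[symmetric] power2_diff field_simps power2_eq_square)
    finally have "\<epsilon> * x\<^sup>2 + b * x \<le> k + \<delta> * x\<^sup>2"
      by (simp add: d_def algebra_simps)
    then show ?thesis by (simp add: x_def flip: exp_add)
  qed
  show ?thesis
    by (rule Bochner_Integration.integrable_bound[OF integrable_mult_right[OF int, of "exp k"]])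
      (use le in auto)
qed

section \<open>Norm, inner product and linear structure\<close>

lemma fock_norm_eq: "fock_norm f = sqrt (\<integral>z. (cmod (f z))\<^sup>2 \<partial>fock_measure)"
  by (simp add: fock_norm_def fock_inner_def flip: complex_norm_square of_real_power)

lemma fock_norm_nonneg [simp]: "fock_norm f \<ge> 0"
  by (simp add: fock_norm_eq integral_nonneg_AE)

lemma fock_norm_square: "(fock_norm f)\<^sup>2 = (\<integral>z. (cmod (f z))\<^sup>2 \<partial>fock_measure)"
  by (simp add: fock_norm_eq integral_nonneg_AE)

text \<open>Stated for measurable functions, so that it also covers the truncations in
  \<open>fock_weak_null\<close>, which are not entire.\<close>

lemma fock_Cauchy_Schwarz:
  fixes f g :: "complex \<Rightarrow> complex"
  assumes [measurable]: "f \<in> borel_measurable borel" "g \<in> borel_measurable borel"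
    and f: "integrable fock_measure (\<lambda>z. (cmod (f z))\<^sup>2)"
    and g: "integrable fock_measure (\<lambda>z. (cmod (g z))\<^sup>2)"
  shows "integrable fock_measure (\<lambda>z. f z * cnj (g z))"
    and "cmod (fock_inner f g) \<le> fock_norm f * fock_norm g"
proof -
  have "integrable fock_measure (\<lambda>z. (cmod (f z))\<^sup>2 + (cmod (g z))\<^sup>2)"
    using f g by simp
  then show int: "integrable fock_measure (\<lambda>z. f z * cnj (g z))"
  proof (rule Bochner_Integration.integrable_bound)
    have "cmod (f z * cnj (g z)) \<le> (cmod (f z))\<^sup>2 + (cmod (g z))\<^sup>2" for z
      using sum_squares_bound[of "cmod (f z)" "cmod (g z)"]
        mult_nonneg_nonneg[OF norm_ge_zero[of "f z"] norm_ge_zero[of "g z"]]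
      unfolding norm_mult complex_mod_cnj by linarith
    then show "AE z in fock_measure. norm (f z * cnj (g z)) \<le> norm ((cmod (f z))\<^sup>2 + (cmod (g z))\<^sup>2)"
      by simp
  qed measurable
  define I where "I = (\<integral>z. cmod (f z) * cmod (g z) \<partial>fock_measure)"
  have intn: "integrable fock_measure (\<lambda>z. cmod (f z) * cmod (g z))"
    using integrable_norm[OF int] by (simp add: norm_mult)
  have I0: "I \<ge> 0" unfolding I_def by simp
  have nnI: "(\<integral>\<^sup>+z. ennreal (cmod (f z)) * ennreal (cmod (g z)) \<partial>fock_measure) = ennreal I"
    unfolding I_def using intn by (subst nn_integral_eq_integral[symmetric]) (auto simp: ennreal_mult)
  have "(ennreal I)\<^sup>2 \<le> ennreal ((fock_norm f)\<^sup>2) * ennreal ((fock_norm g)\<^sup>2)"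
    using Cauchy_Schwarz_nn_integral[of "\<lambda>z. ennreal (cmod (f z))" fock_measure "\<lambda>z. ennreal (cmod (g z))"] f g
    by (simp add: nnI ennreal_power nn_integral_eq_integral fock_norm_square)
  then have "I\<^sup>2 \<le> (fock_norm f * fock_norm g)\<^sup>2"
    using I0 by (simp add: ennreal_power ennreal_mult[symmetric] power_mult_distrib)
  then have "I \<le> fock_norm f * fock_norm g"
    by (rule power2_le_imp_le) simp
  moreover have "cmod (fock_inner f g) \<le> I"
    using integral_norm_bound[of fock_measure "\<lambda>z. f z * cnj (g z)"]
    by (simp add: fock_inner_def I_def norm_mult)
  ultimately show "cmod (fock_inner f g) \<le> fock_norm f * fock_norm g" by simp
qed

lemma fock_spaceD:
  assumes "f \<in> fock_space"
  shows "f holomorphic_on UNIV" "f \<in> borel_measurable borel"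
    "integrable fock_measure (\<lambda>z. (cmod (f z))\<^sup>2)"
  using assms holomorphic_borel_measurable by (auto simp: fock_space_def)

lemma fock_inner_integrable:
  "f \<in> fock_space \<Longrightarrow> g \<in> fock_space \<Longrightarrow> integrable fock_measure (\<lambda>z. f z * cnj (g z))"
  by (simp add: fock_Cauchy_Schwarz fock_spaceD)

lemma fock_inner_le:
  "f \<in> fock_space \<Longrightarrow> g \<in> fock_space \<Longrightarrow> cmod (fock_inner f g) \<le> fock_norm f * fock_norm g"
  by (simp add: fock_Cauchy_Schwarz fock_spaceD)

lemma fock_space_scale: "f \<in> fock_space \<Longrightarrow> (\<lambda>z. c * f z) \<in> fock_space"
  by (auto simp: fock_space_def norm_mult power_mult_distrib intro!: holomorphic_intros)

lemma fock_space_add: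
  assumes "f \<in> fock_space" "g \<in> fock_space"
  shows "(\<lambda>z. f z + g z) \<in> fock_space"
proof -
  note [measurable] = fock_spaceD(2)[OF assms(1)] fock_spaceD(2)[OF assms(2)]
  have "integrable fock_measure (\<lambda>z. 2 * (cmod (f z))\<^sup>2 + 2 * (cmod (g z))\<^sup>2)"
    using assms by (simp add: fock_spaceD)
  then have "integrable fock_measure (\<lambda>z. (cmod (f z + g z))\<^sup>2)"
  proof (rule Bochner_Integration.integrable_bound)
    have "(cmod (f z + g z))\<^sup>2 \<le> 2 * (cmod (f z))\<^sup>2 + 2 * (cmod (g z))\<^sup>2" for z
    proof -
      have "(cmod (f z + g z))\<^sup>2 \<le> (cmod (f z) + cmod (g z))\<^sup>2"
        by (intro power_mono norm_triangle_ineq) simp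
      also have "\<dots> \<le> 2 * (cmod (f z))\<^sup>2 + 2 * (cmod (g z))\<^sup>2"
        using sum_squares_bound[of "cmod (f z)" "cmod (g z)"] by (simp add: power2_sum)
      finally show ?thesis .
    qed
    then show "AE z in fock_measure. norm ((cmod (f z + g z))\<^sup>2) \<le> norm (2 * (cmod (f z))\<^sup>2 + 2 * (cmod (g z))\<^sup>2)"
      by simp
  qed measurable
  then show ?thesis
    using assms by (auto simp: fock_space_def intro!: holomorphic_intros)
qed

lemma fock_space_diff:
  "f \<in> fock_space \<Longrightarrow> g \<in> fock_space \<Longrightarrow> (\<lambda>z. f z - g z) \<in> fock_space"
  using fock_space_add[of f "\<lambda>z. - 1 * g z"] fock_space_scale[of g "-1"] by simp

lemma fock_space_zero: "(\<lambda>z. 0) \<in> fock_space"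
  by (simp add: fock_space_def)

lemma fock_space_sum:
  "(\<And>i. i \<in> I \<Longrightarrow> f i \<in> fock_space) \<Longrightarrow> (\<lambda>z. \<Sum>i\<in>I. f i z) \<in> fock_space"
  by (induction I rule: infinite_finite_induct) (auto simp: fock_space_zero fock_space_add)

lemma fock_inner_cnj: "fock_inner g f = cnj (fock_inner f g)"
  unfolding fock_inner_def by (subst Bochner_Integration.integral_cnj[symmetric]) (simp add: mult.commute)

lemma fock_inner_diff_left:
  "f \<in> fock_space \<Longrightarrow> g \<in> fock_space \<Longrightarrow> h \<in> fock_space \<Longrightarrow>
   fock_inner (\<lambda>z. f z - g z) h = fock_inner f h - fock_inner g h"
  unfolding fock_inner_def by (simp add: left_diff_distrib fock_inner_integrable)

lemma fock_inner_diff_right: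
  "f \<in> fock_space \<Longrightarrow> g \<in> fock_space \<Longrightarrow> h \<in> fock_space \<Longrightarrow>
   fock_inner h (\<lambda>z. f z - g z) = fock_inner h f - fock_inner h g"
  unfolding fock_inner_def by (simp add: right_diff_distrib fock_inner_integrable)

lemma fock_inner_scale_left: "fock_inner (\<lambda>z. c * f z) h = c * fock_inner f h"
  unfolding fock_inner_def by (simp add: mult.assoc)

lemma fock_inner_scale_right: "fock_inner h (\<lambda>z. c * f z) = cnj c * fock_inner h f"
  unfolding fock_inner_def by (simp add: mult.left_commute)

lemma fock_inner_self: "fock_inner f f = of_real ((fock_norm f)\<^sup>2)"
  unfolding fock_inner_def fock_norm_square by (simp flip: complex_norm_square of_real_power)

section \<open>Rotation averages and Taylor coefficients\<close>

text \<open>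
  Averaging over rotations replaces \<open>f\<close> by a single term of its Taylor series at \<open>0\<close>.
\<close>

lemma circle_average_Taylor_coefficient:
  assumes "f holomorphic_on UNIV"
  shows "((\<lambda>t. f (exp (2 * of_real pi * \<i> * of_real t) * z) * exp (- (2 * of_real pi * \<i> * of_real t)) ^ n)
    has_integral (deriv ^^ n) f 0 / fact n * z ^ n) {0..1::real}"
proof -
  let ?e = "\<lambda>t::real. exp (2 * of_real pi * \<i> * of_real t)"
  \<comment> \<open>Cauchy's formula is applied on the unit circle in the variable \<open>u\<close>;
    the chain rule then supplies the factor \<open>z ^ n\<close>.\<close>
  define g where "g u = f (z * u)" for u
  have hol: "g holomorphic_on S" for S
    unfolding g_def using holomorphic_on_compose_gen[of "\<lambda>u. z * u" S f UNIV] assms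
    by (auto simp: o_def intro!: holomorphic_intros)
  have "((\<lambda>u. g u / (u - 0) ^ Suc n) has_contour_integral (2 * pi * \<i>) / fact n * (deriv ^^ n) g 0) (circlepath 0 1)"
    using hol by (intro Cauchy_has_contour_integral_higher_derivative_circlepath holomorphic_on_imp_continuous_on) auto
  then have "((\<lambda>t. g (?e t) / ?e t ^ Suc n * (2 * pi * \<i> * ?e t)) has_integral
      (2 * pi * \<i>) / fact n * (deriv ^^ n) g 0) {0..1}"
    unfolding has_contour_integral vector_derivative_circlepath by (simp add: circlepath)
  then have "((\<lambda>t. g (?e t) / ?e t ^ Suc n * (2 * pi * \<i> * ?e t) * inverse (2 * pi * \<i>)) has_integral
      (2 * pi * \<i>) / fact n * (deriv ^^ n) g 0 * inverse (2 * pi * \<i>)) {0..1}"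
    by (rule has_integral_mult_left)
  moreover have "(2 * pi * \<i>) / fact n * (deriv ^^ n) g 0 * inverse (2 * pi * \<i>) = (deriv ^^ n) f 0 / fact n * z ^ n"
    unfolding g_def using higher_deriv_compose_linear[OF assms open_UNIV open_UNIV, of 0 z n]
    by (simp add: field_simps)
  moreover have "g (?e t) / ?e t ^ Suc n * (2 * pi * \<i> * ?e t) * inverse (2 * pi * \<i>)
      = f (?e t * z) * exp (- (2 * of_real pi * \<i> * of_real t)) ^ n" for t
    by (simp add: g_def exp_minus field_simps power_inverse)
  ultimately show ?thesis by simp
qed

text \<open>The measure is rotation invariant, so the integral equals its average over all
  rotations, and Fubini moves this average inside. Integrability of the product, instead of
  \<open>f \<in> fock_space\<close>, is what is at hand when \<open>fock_inner_kernel\<close>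
  applies the case \<open>n = 0\<close>.\<close>

lemma fock_integral_Taylor_coefficient:
  assumes hol: "f holomorphic_on UNIV"
    and int: "integrable fock_measure (\<lambda>z. f z * cnj (z ^ n))"
  shows "(\<integral>z. f z * cnj (z ^ n) \<partial>fock_measure)
    = (deriv ^^ n) f 0 / fact n * of_real (\<integral>z. cmod z ^ (2 * n) \<partial>fock_measure)"
proof -
  define e :: "real \<Rightarrow> complex" where "e t = exp (2 * of_real pi * \<i> * of_real t)" for t
  have ne: "cmod (e t) = 1" for t by (simp add: e_def)
  have inv: "cnj (e t) = exp (- (2 * of_real pi * \<i> * of_real t))" for t
    by (simp add: e_def exp_cnj)
  define M where "M = restrict_space (lborel :: real measure) {0..1}"
  interpret M: finite_measure M
    by (rule finite_measureI) (simp add: M_def emeasure_restrict_space space_restrict_space)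
  interpret P: pair_sigma_finite M fock_measure
    by (simp add: pair_sigma_finite_def M.sigma_finite_measure_axioms fock.sigma_finite_measure_axioms)
  let ?F = "\<lambda>t z. f (e t * z) * cnj ((e t * z) ^ n)"
  note [measurable] = holomorphic_borel_measurable[OF hol]
  have [measurable]: "e \<in> borel_measurable M"
    unfolding M_def e_def by (intro measurable_restrict_space1) measurable
  have meas: "case_prod ?F \<in> borel_measurable (M \<Otimes>\<^sub>M fock_measure)"
    by measurable
  have rot: "integrable fock_measure (?F t)" "(\<integral>z. ?F t z \<partial>fock_measure) = (\<integral>z. f z * cnj (z ^ n) \<partial>fock_measure)"
    "(\<integral>z. norm (?F t z) \<partial>fock_measure) = (\<integral>z. norm (f z * cnj (z ^ n)) \<partial>fock_measure)" for t
    using fock_rotate[of "\<lambda>z. f z * cnj (z ^ n)" "e t"]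
      fock_rotate(2)[of "\<lambda>z. norm (f z * cnj (z ^ n))" "e t"] ne int by simp_all
  have intP: "integrable (M \<Otimes>\<^sub>M fock_measure) (case_prod ?F)"
  proof (rule P.Fubini_integrable[OF meas])
    show "integrable M (\<lambda>t. \<integral>z. norm (case_prod ?F (t, z)) \<partial>fock_measure)"
      unfolding prod.case rot(3) by simp
    show "AE t in M. integrable fock_measure (\<lambda>z. case_prod ?F (t, z))"
      unfolding prod.case by (intro AE_I2 rot(1))
  qed
  have avg: "(\<integral>t. ?F t z \<partial>M) = (deriv ^^ n) f 0 / fact n * of_real (cmod z ^ (2 * n))" for z
  proof -
    have "((\<lambda>t. f (e t * z) * cnj (e t) ^ n) has_integral (deriv ^^ n) f 0 / fact n * z ^ n) {0..1}"
      using circle_average_Taylor_coefficient[OF hol] unfolding inv unfolding e_def .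
    then have hi: "((\<lambda>t. f (e t * z) * cnj (e t) ^ n * cnj (z ^ n)) has_integral (deriv ^^ n) f 0 / fact n * z ^ n * cnj (z ^ n)) {0..1}"
      by (rule has_integral_mult_left)
    have F: "?F t z = f (e t * z) * cnj (e t) ^ n * cnj (z ^ n)" for t
      by (simp add: power_mult_distrib)
    have cont: "continuous_on {0..1} (\<lambda>t. ?F t z)"
      unfolding e_def
      by (intro continuous_intros continuous_on_compose2[OF holomorphic_on_imp_continuous_on[OF hol]]) auto
    have "(\<integral>t. ?F t z \<partial>M) = set_lebesgue_integral lborel {0..1} (\<lambda>t. ?F t z)"
      by (simp add: M_def integral_restrict_space set_lebesgue_integral_def)
    also have "\<dots> = integral {0..1} (\<lambda>t. ?F t z)"
      by (rule set_borel_integral_eq_integral) (rule borel_integrable_atLeastAtMost'[OF cont])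
    also have "\<dots> = (deriv ^^ n) f 0 / fact n * z ^ n * cnj (z ^ n)"
      using hi unfolding F by (rule integral_unique)
    also have "z ^ n * cnj (z ^ n) = of_real (cmod z ^ (2 * n))"
      using complex_norm_square[of "z ^ n"] by (simp add: norm_power power_mult power_even_eq mult.commute)
    then have "(deriv ^^ n) f 0 / fact n * z ^ n * cnj (z ^ n) = (deriv ^^ n) f 0 / fact n * of_real (cmod z ^ (2 * n))"
      by (simp add: mult.assoc)
    finally show ?thesis .
  qed
  have "measure M (space M) = 1"
    by (simp add: M_def measure_restrict_space space_restrict_space)
  then have "(\<integral>z. f z * cnj (z ^ n) \<partial>fock_measure) = (\<integral>t. \<integral>z. ?F t z \<partial>fock_measure \<partial>M)"
    unfolding rot by simp
  also have "\<dots> = (\<integral>z. \<integral>t. ?F t z \<partial>M \<partial>fock_measure)"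
    using P.Fubini_integral[OF intP] by simp
  also have "\<dots> = (deriv ^^ n) f 0 / fact n * of_real (\<integral>z. cmod z ^ (2 * n) \<partial>fock_measure)"
    unfolding avg by (simp flip: of_real_power)
  finally show ?thesis .
qed

section \<open>Entire functions of exponential growth\<close>

lemma fock_space_exponential_growth:
  assumes hol: "f holomorphic_on UNIV" and bound: "\<And>z. cmod (f z) \<le> C * exp (b * cmod z)"
  shows "f \<in> fock_space"
proof -
  note [measurable] = holomorphic_borel_measurable[OF hol]
  have le: "(cmod (f z))\<^sup>2 \<le> C\<^sup>2 * exp (0 * (cmod z)\<^sup>2 + 2 * b * cmod z)" for z
  proof -
    have "(cmod (f z))\<^sup>2 \<le> (C * exp (b * cmod z))\<^sup>2"
      by (rule power_mono[OF bound]) simp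
    then show ?thesis
      by (simp add: power_mult_distrib mult.assoc flip: exp_double)
  qed
  have int: "integrable fock_measure (\<lambda>z. C\<^sup>2 * exp (0 * (cmod z)\<^sup>2 + 2 * b * cmod z))"
    by (intro integrable_mult_right fock_integrable_gaussian) simp
  have "integrable fock_measure (\<lambda>z. (cmod (f z))\<^sup>2)"
    by (rule Bochner_Integration.integrable_bound[OF int]) (use le in auto)
  then show ?thesis using hol by (simp add: fock_space_def)
qed

lemma holomorphic_compose_affine:
  assumes "f holomorphic_on UNIV"
  shows "(\<lambda>z. f (A * z + B)) holomorphic_on UNIV"
proof -
  have "f \<circ> (\<lambda>z. A * z + B) holomorphic_on UNIV"
    by (rule holomorphic_on_compose_gen[OF _ assms]) (auto intro!: holomorphic_intros)
  then show ?thesis by (simp add: o_def)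
qed

lemma cmod_exp_le: "cmod (exp z) \<le> exp (cmod z)"
  by (simp add: complex_Re_le_cmod)

lemma power_le_exp: "x \<ge> 0 \<Longrightarrow> x ^ n \<le> exp (real n * x)" for x :: real
  using exp_ge_add_one_self[of x] unfolding exp_of_nat_mult by (intro power_mono) linarith+

text \<open>One family that contains the monomials, the reproducing kernels and the images of
  monomials under \<open>affine_comp\<close>.\<close>

lemma fock_space_exp_affine_power: "(\<lambda>z. C * exp (D * z) * (A * z + B) ^ n) \<in> fock_space"
proof (rule fock_space_exponential_growth)
  show "(\<lambda>z. C * exp (D * z) * (A * z + B) ^ n) holomorphic_on UNIV"
    by (intro holomorphic_intros)
  fix z
  have "cmod (A * z + B) ^ n \<le> exp (n * cmod (A * z + B))"
    by (rule power_le_exp) simp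
  also have "\<dots> \<le> exp (n * (cmod A * cmod z + cmod B))"
    using norm_triangle_ineq[of "A * z" B] by (auto simp: norm_mult intro!: mult_left_mono)
  finally have 1: "cmod (A * z + B) ^ n \<le> exp (n * (cmod A * cmod z + cmod B))" .
  have 2: "cmod (exp (D * z)) \<le> exp (cmod D * cmod z)"
    using cmod_exp_le[of "D * z"] by (simp add: norm_mult)
  have "cmod (C * exp (D * z) * (A * z + B) ^ n)
      \<le> cmod C * (exp (cmod D * cmod z) * exp (n * (cmod A * cmod z + cmod B)))"
    unfolding norm_mult norm_power mult.assoc
    by (intro mult_left_mono mult_mono 1[unfolded norm_mult norm_power] 2[unfolded norm_mult norm_power]) auto
  also have "\<dots> = (cmod C * exp (n * cmod B)) * exp ((cmod D + n * cmod A) * cmod z)"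
    by (simp add: algebra_simps flip: exp_add)
  finally show "cmod (C * exp (D * z) * (A * z + B) ^ n)
      \<le> (cmod C * exp (n * cmod B)) * exp ((cmod D + n * cmod A) * cmod z)" .
qed

lemma fock_space_power: "(\<lambda>z. z ^ n) \<in> fock_space"
  using fock_space_exp_affine_power[of 1 0 1 0 n] by simp

section \<open>The reproducing kernel\<close>

definition fock_kernel :: "complex \<Rightarrow> complex \<Rightarrow> complex" where
  "fock_kernel w z = exp (z * cnj w)"

lemma fock_kernel_in_fock_space: "fock_kernel w \<in> fock_space"
  using fock_space_exp_affine_power[of 1 "cnj w" 0 0 0]
  by (simp add: fock_kernel_def[abs_def] mult.commute)

text \<open>Translation by \<open>w\<close> moves the evaluation point to the origin. The Gaussian
  quotient and the conjugated kernel then combine to the holomorphic factor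
  \<open>exp (- (z * cnj w))\<close>, so the integral is a mean value at 0, where this factor is
  1.\<close>

lemma fock_inner_kernel:
  assumes f: "f \<in> fock_space"
  shows "fock_inner f (fock_kernel w) = f w"
proof -
  note [measurable] = fock_spaceD(2)[OF f] fock_spaceD(2)[OF fock_kernel_in_fock_space[of w]]
  let ?F = "\<lambda>z. f z * cnj (fock_kernel w z)" and ?g = "\<lambda>z. f (z + w) * exp (- (z * cnj w))"
  have eq: "exp ((cmod z)\<^sup>2 - (cmod (1 * z + w))\<^sup>2) *\<^sub>R ?F (1 * z + w) = ?g z" for z
  proof -
    have "complex_of_real ((cmod z)\<^sup>2 - (cmod (z + w))\<^sup>2) + cnj ((z + w) * cnj w) = - (z * cnj w)"
      by (simp only: of_real_diff complex_norm_square) (simp add: algebra_simps)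
    then have "exp (complex_of_real ((cmod z)\<^sup>2 - (cmod (z + w))\<^sup>2)) * exp (cnj ((z + w) * cnj w)) = exp (- (z * cnj w))"
      by (simp only: flip: exp_add)
    then show ?thesis
      by (simp add: fock_kernel_def scaleR_conv_of_real exp_of_real exp_cnj mult.left_commute del: complex_cnj_mult of_real_diff)
  qed
  have int: "integrable fock_measure ?F"
    using f fock_kernel_in_fock_space by (rule fock_inner_integrable)
  then have int': "integrable fock_measure ?g"
    using fock_change_of_variables(1)[of ?F 1 w] unfolding eq by simp
  have hol: "?g holomorphic_on UNIV"
    using holomorphic_compose_affine[OF fock_spaceD(1)[OF f], of 1 w] by (auto intro!: holomorphic_intros)
  have "fock_inner f (fock_kernel w) = (\<integral>z. ?g z \<partial>fock_measure)"
    unfolding fock_inner_def using fock_change_of_variables(2)[of ?F 1 w] unfolding eq by simp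
  also have "\<dots> = f w"
    using fock_integral_Taylor_coefficient[OF hol, of 0] int' fock.prob_space by simp
  finally show ?thesis .
qed

lemma fock_norm_kernel: "fock_norm (fock_kernel w) = exp ((cmod w)\<^sup>2 / 2)"
proof -
  have "complex_of_real ((fock_norm (fock_kernel w))\<^sup>2) = fock_kernel w w"
    unfolding fock_inner_self[symmetric] by (rule fock_inner_kernel[OF fock_kernel_in_fock_space])
  also have "\<dots> = of_real (exp ((cmod w)\<^sup>2))"
    by (simp only: fock_kernel_def complex_norm_square[symmetric] exp_of_real)
  finally have "(fock_norm (fock_kernel w))\<^sup>2 = (exp ((cmod w)\<^sup>2 / 2))\<^sup>2"
    by (simp only: of_real_eq_iff) (simp flip: exp_double)
  then show ?thesis by (rule power2_eq_imp_eq) auto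
qed

lemma fock_pointwise_bound:
  assumes "f \<in> fock_space"
  shows "cmod (f z) \<le> fock_norm f * exp ((cmod z)\<^sup>2 / 2)"
  using fock_inner_le[OF assms fock_kernel_in_fock_space[of z]]
  by (simp add: fock_inner_kernel[OF assms] fock_norm_kernel)

lemma fock_norm_zero_imp: "f \<in> fock_space \<Longrightarrow> fock_norm f = 0 \<Longrightarrow> f z = 0"
  using fock_pointwise_bound[of f z] by simp

lemma fock_norm_convergence_pointwise:
  assumes "f \<in> fock_space" "\<And>n. X n \<in> fock_space"
    and "(\<lambda>n. fock_norm (\<lambda>z. X n z - f z)) \<longlonglongrightarrow> 0"
  shows "(\<lambda>n. X n z) \<longlonglongrightarrow> f z"
proof -
  have "cmod (X n z - f z) \<le> fock_norm (\<lambda>z. X n z - f z) * exp ((cmod z)\<^sup>2 / 2)" for n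
    using fock_pointwise_bound[OF fock_space_diff[OF assms(2,1)]] .
  then have "\<forall>\<^sub>F n in sequentially. norm (X n z - f z) \<le> fock_norm (\<lambda>z. X n z - f z) * exp ((cmod z)\<^sup>2 / 2)"
    by (intro always_eventually allI)
  then have "(\<lambda>n. X n z - f z) \<longlonglongrightarrow> 0"
    by (rule Lim_null_comparison) (rule tendsto_mult_left_zero[OF assms(3)])
  then show ?thesis by (rule LIM_zero_cancel)
qed

section \<open>Orthogonality of monomials and density of polynomials\<close>

lemma fock_inner_sum_right:
  assumes "\<And>i. i \<in> I \<Longrightarrow> f i \<in> fock_space" "h \<in> fock_space"
  shows "fock_inner h (\<lambda>z. \<Sum>i\<in>I. f i z) = (\<Sum>i\<in>I. fock_inner h (f i))"
  unfolding fock_inner_def using assms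
  by (simp add: sum_distrib_left fock_inner_integrable cong: sum.cong)

lemma fock_inner_power:
  assumes "f \<in> fock_space"
  shows "fock_inner f (\<lambda>z. z ^ n) = (deriv ^^ n) f 0 / fact n * of_real ((fock_norm (\<lambda>z. z ^ n))\<^sup>2)"
proof -
  have "(\<integral>z. cmod z ^ (2 * n) \<partial>fock_measure) = (fock_norm (\<lambda>z. z ^ n))\<^sup>2"
    unfolding fock_norm_square by (simp add: norm_power flip: power_mult) (simp add: mult.commute)
  then show ?thesis
    using fock_integral_Taylor_coefficient[OF fock_spaceD(1)[OF assms], of n]
      fock_inner_integrable[OF assms fock_space_power] by (simp add: fock_inner_def)
qed

lemma fock_inner_power_power:
  "fock_inner (\<lambda>z. z ^ m) (\<lambda>z. z ^ n) = (if m = n then of_real ((fock_norm (\<lambda>z. z ^ n))\<^sup>2) else 0)"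
proof -
  have "(deriv ^^ n) (\<lambda>z. z ^ m) (0::complex) = pochhammer (of_nat (Suc m - n)) n * 0 ^ (m - n)"
    using higher_deriv_power[of n 0 m 0] by simp
  also have "\<dots> = (if m = n then fact n else 0)"
    \<comment> \<open>For \<open>m < n\<close> truncated subtraction gives a Pochhammer symbol with
      base 0, which vanishes because \<open>n > 0\<close>; for \<open>m > n\<close> the power of 0
      vanishes.\<close>
    by (cases m n rule: linorder_cases) (auto simp: pochhammer_fact pochhammer_0_left)
  finally show ?thesis
    by (subst fock_inner_power[OF fock_space_power]) simp
qed

text \<open>By Pythagoras the squared error is \<open>(fock_norm f)\<^sup>2 - T N\<close>, with
  \<open>T N\<close> the squared norm of the partial sum. \<open>T\<close> is increasing and
  bounded, and Fatou's lemma along the pointwise convergent Taylor series shows that its limit is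
  not smaller than \<open>(fock_norm f)\<^sup>2\<close>.\<close>

lemma fock_Taylor_convergence:
  fixes f :: "complex \<Rightarrow> complex"
  assumes f: "f \<in> fock_space"
  defines "s \<equiv> (\<lambda>N z. \<Sum>n<N. (deriv ^^ n) f 0 / fact n * z ^ n)"
  shows "(\<lambda>N. fock_norm (\<lambda>z. f z - s N z)) \<longlonglongrightarrow> 0"
proof -
  define a where "a n = (deriv ^^ n) f 0 / fact n" for n
  define c where "c n = (fock_norm (\<lambda>z. z ^ n))\<^sup>2" for n
  define T where "T N = (\<Sum>n<N. (cmod (a n))\<^sup>2 * c n)" for N
  have s_eq: "s N = (\<lambda>z. \<Sum>n<N. a n * z ^ n)" for N by (simp add: s_def a_def)
  have s_in: "s N \<in> fock_space" for N
    unfolding s_eq by (intro fock_space_sum fock_space_scale fock_space_power)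
  have fs: "fock_inner h (s N) = (\<Sum>n<N. cnj (a n) * fock_inner h (\<lambda>z. z ^ n))" if "h \<in> fock_space" for h N
    unfolding s_eq using that
    by (subst fock_inner_sum_right) (auto simp: fock_space_scale fock_space_power fock_inner_scale_right)
  have "fock_inner f (s N) = of_real (T N)" for N
    unfolding fs[OF f] fock_inner_power[OF f] T_def a_def[symmetric] c_def[symmetric]
    by (simp add: complex_norm_square[unfolded of_real_power] mult_ac)
  moreover from this have "fock_inner (s N) f = of_real (T N)" for N
    by (subst fock_inner_cnj) simp
  moreover have sn: "fock_inner (s N) (\<lambda>z. z ^ n) = (if n < N then a n * c n else 0)" for n N
  proof -
    have "fock_inner (s N) (\<lambda>z. z ^ n) = cnj (fock_inner (\<lambda>z. z ^ n) (s N))"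
      by (rule fock_inner_cnj)
    also have "\<dots> = (\<Sum>m<N. if n = m then a m * c m else 0)"
      unfolding fs[OF fock_space_power] fock_inner_power_power c_def[symmetric]
      by (simp add: if_distrib cong: if_cong)
    also have "\<dots> = (if n < N then a n * c n else 0)"
      by simp
    finally show ?thesis .
  qed
  moreover have ss: "fock_inner (s N) (s N) = of_real (T N)" for N
    unfolding fs[OF s_in] sn T_def
    by (simp add: complex_norm_square[unfolded of_real_power] mult_ac)
  ultimately have "fock_inner (\<lambda>z. f z - s N z) (\<lambda>z. f z - s N z) = of_real ((fock_norm f)\<^sup>2 - T N)" for N
    by (simp add: fock_inner_diff_left fock_inner_diff_right fock_space_diff f s_in fock_inner_self[of f])
  then have norm_diff: "(fock_norm (\<lambda>z. f z - s N z))\<^sup>2 = (fock_norm f)\<^sup>2 - T N" for N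
    unfolding fock_inner_self by (simp only: of_real_eq_iff)
  have T_le: "T N \<le> (fock_norm f)\<^sup>2" for N
    using norm_diff[of N] zero_le_power2[of "fock_norm (\<lambda>z. f z - s N z)"] by linarith
  have "incseq T"
    unfolding T_def c_def by (intro incseq_SucI) simp
  then obtain L where L: "T \<longlonglongrightarrow> L" and TL: "\<And>N. T N \<le> L"
    using incseq_convergent[OF _ , of T "(fock_norm f)\<^sup>2"] T_le by metis
  have lim: "(\<lambda>N. s N z) \<longlonglongrightarrow> f z" for z
    using holomorphic_power_series[of f 0 "cmod z + 1" z] holomorphic_on_subset[OF fock_spaceD(1)[OF f]]
    by (simp add: sums_def s_def)
  note [measurable] = fock_spaceD(2)[OF s_in]
  have nns: "(\<integral>\<^sup>+z. ennreal ((cmod (s N z))\<^sup>2) \<partial>fock_measure) = ennreal (T N)" for N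
  proof -
    have "(fock_norm (s N))\<^sup>2 = T N"
      using ss[of N] unfolding fock_inner_self by (simp only: of_real_eq_iff)
    then show ?thesis
      using fock_spaceD(3)[OF s_in, of N] by (subst nn_integral_eq_integral) (auto simp flip: fock_norm_square)
  qed
  have "ennreal ((fock_norm f)\<^sup>2) = (\<integral>\<^sup>+z. ennreal ((cmod (f z))\<^sup>2) \<partial>fock_measure)"
    using fock_spaceD(3)[OF f] by (subst nn_integral_eq_integral) (auto simp flip: fock_norm_square)
  also have "\<dots> = (\<integral>\<^sup>+z. liminf (\<lambda>N. ennreal ((cmod (s N z))\<^sup>2)) \<partial>fock_measure)"
    by (simp add: lim_imp_Liminf[OF sequentially_bot tendsto_ennrealI[OF tendsto_power[OF tendsto_norm[OF lim]]]])
  also have "\<dots> \<le> liminf (\<lambda>N. \<integral>\<^sup>+z. ennreal ((cmod (s N z))\<^sup>2) \<partial>fock_measure)"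
    by (rule nn_integral_liminf) measurable
  also have "\<dots> = ennreal L"
    unfolding nns by (rule lim_imp_Liminf[OF sequentially_bot tendsto_ennrealI[OF L]])
  finally have "(fock_norm f)\<^sup>2 \<le> L"
    \<comment> \<open>Since \<open>T 0 = 0\<close>, the instance at 0 says that \<open>L\<close> is
      nonnegative, which is what removing \<open>ennreal\<close> requires.\<close>
    using TL[of 0] by (simp add: T_def ennreal_le_iff)
  moreover have "L \<le> (fock_norm f)\<^sup>2"
    by (rule LIMSEQ_le_const2[OF L]) (use T_le in auto)
  ultimately have "(\<lambda>N. (fock_norm f)\<^sup>2 - T N) \<longlonglongrightarrow> 0"
    using tendsto_diff[OF tendsto_const L, of "(fock_norm f)\<^sup>2"] by simp
  then have "(\<lambda>N. sqrt ((fock_norm (\<lambda>z. f z - s N z))\<^sup>2)) \<longlonglongrightarrow> sqrt 0"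
    unfolding norm_diff by (rule tendsto_real_sqrt)
  then show ?thesis by simp
qed

section \<open>Uniqueness of the adjoint\<close>

text \<open>The difference of two candidates is orthogonal to the dense domain. If it were nonzero,
  a domain element closer to it than its own norm would violate Cauchy-Schwarz.\<close>

lemma adjoint_rel_unique:
  assumes dense: "densely_defined T" and dom: "dom T \<subseteq> fock_space"
    and 1: "adjoint_rel T g h1" and 2: "adjoint_rel T g h2"
  shows "h1 = h2"
proof -
  have h12: "h1 \<in> fock_space" "h2 \<in> fock_space" using 1 2 by (auto simp: adjoint_rel_def)
  define h where "h z = h1 z - h2 z" for z
  have h: "h \<in> fock_space" unfolding h_def using h12 by (rule fock_space_diff)
  have orth: "fock_inner f h = 0" if "f \<in> dom T" for f
  proof -
    have "fock_inner f h1 = fock_inner f h2"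
      using 1 2 that unfolding adjoint_rel_def by metis
    then show ?thesis
      unfolding h_def using that dom h12 by (subst fock_inner_diff_right) auto
  qed
  have "fock_norm h = 0"
  proof (rule ccontr)
    assume ne: "fock_norm h \<noteq> 0"
    then have pos: "fock_norm h > 0" using fock_norm_nonneg[of h] by linarith
    with dense h obtain f where f: "f \<in> dom T" "fock_norm (\<lambda>z. h z - f z) < fock_norm h"
      unfolding densely_defined_def by blast
    have fF: "f \<in> fock_space" using f dom by auto
    have "of_real ((fock_norm h)\<^sup>2) = fock_inner h h" by (simp add: fock_inner_self)
    also have "\<dots> = fock_inner (\<lambda>z. h z - f z) h"
      using fock_inner_diff_left[OF h fF h] orth[OF f(1)] by simp
    finally have "cmod (of_real ((fock_norm h)\<^sup>2)) \<le> fock_norm (\<lambda>z. h z - f z) * fock_norm h"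
      using fock_inner_le[OF fock_space_diff[OF h fF] h] by simp
    then have "fock_norm h * fock_norm h \<le> fock_norm (\<lambda>z. h z - f z) * fock_norm h"
      by (simp add: power2_eq_square norm_mult)
    with f(2) pos show False by simp
  qed
  then have "h z = 0" for z using fock_norm_zero_imp[OF h] by blast
  then show ?thesis by (auto simp: h_def)
qed

lemma adjoint_op_eq_Some_iff:
  assumes "densely_defined T" "dom T \<subseteq> fock_space"
  shows "adjoint_op T g = Some h \<longleftrightarrow> adjoint_rel T g h"
proof -
  have the: "(THE h. adjoint_rel T g h) = h" if "adjoint_rel T g h" for h
    using that adjoint_rel_unique[OF assms] by (intro the_equality) blast+
  show ?thesis
    using the unfolding adjoint_op_def by (auto split: if_splits)
qed

section \<open>Composition with affine maps\<close>

text \<open>The weighted composition with an exponential weight and an affine symbol. The family is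
  closed under the formal adjoint, which conjugates all four parameters and interchanges the roles
  of \<open>B\<close> and \<open>D\<close>.\<close>

definition affine_comp :: "complex \<Rightarrow> complex \<Rightarrow> complex \<Rightarrow> complex \<Rightarrow> (complex \<Rightarrow> complex) \<Rightarrow> complex \<Rightarrow> complex" where
  "affine_comp A B C D f z = C * exp (D * z) * f (A * z + B)"

lemma affine_comp_holomorphic:
  "f holomorphic_on UNIV \<Longrightarrow> affine_comp A B C D f holomorphic_on UNIV"
  unfolding affine_comp_def[abs_def] by (intro holomorphic_intros holomorphic_compose_affine)

lemma affine_comp_kernel:
  "affine_comp A B C D (fock_kernel w) z = C * exp (B * cnj w) * fock_kernel (cnj A * w + cnj D) z"
  by (simp add: affine_comp_def fock_kernel_def algebra_simps flip: exp_add)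

lemma affine_comp_kernel_in_fock_space: "affine_comp A B C D (fock_kernel w) \<in> fock_space"
  unfolding affine_comp_kernel[abs_def] by (intro fock_space_scale fock_kernel_in_fock_space)

lemma affine_comp_power_in_fock_space: "affine_comp A B C D (\<lambda>z. z ^ n) \<in> fock_space"
  unfolding affine_comp_def[abs_def] by (rule fock_space_exp_affine_power)

lemma two_Re: "complex_of_real (2 * Re z) = z + cnj z"
  by (simp add: complex_add_cnj)

text \<open>
  The two integrands are related by the affine map \<open>v \<mapsto> (A v + B - cnj D) / cnj A\<close>, whose linear
  part is a rotation; the hypothesis on \<open>D\<close> makes the linear terms of the two Gaussian
  exponents agree.
\<close>

lemma affine_comp_adjoint_norm:
  assumes f: "f holomorphic_on UNIV" and A: "A \<noteq> 0" and rel: "D * (1 - cnj A) = cnj B * (1 - A)"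
  shows "affine_comp (cnj A) (cnj D) (cnj C) (cnj B) f \<in> fock_space \<longleftrightarrow> affine_comp A B C D f \<in> fock_space"
    and "(fock_norm (affine_comp (cnj A) (cnj D) (cnj C) (cnj B) f))\<^sup>2
      = exp (((cmod B)\<^sup>2 - (cmod D)\<^sup>2) / (cmod A)\<^sup>2) * (fock_norm (affine_comp A B C D f))\<^sup>2"
proof -
  let ?W = "affine_comp A B C D f" and ?H = "affine_comp (cnj A) (cnj D) (cnj C) (cnj B) f"
  define \<kappa> where "\<kappa> = exp (((cmod B)\<^sup>2 - (cmod D)\<^sup>2) / (cmod A)\<^sup>2)"
  define c where "c = A / cnj A"
  define b where "b = (B - cnj D) / cnj A"
  have c: "c \<noteq> 0" "cmod c = 1" using A by (auto simp: c_def norm_divide)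
  have hol: "?W holomorphic_on UNIV" "?H holomorphic_on UNIV"
    using f by (auto intro: affine_comp_holomorphic)
  note [measurable] = hol[THEN holomorphic_borel_measurable]
  have key: "exp ((cmod v)\<^sup>2 - (cmod (c * v + b))\<^sup>2) *\<^sub>R (cmod (?H (c * v + b)))\<^sup>2 = \<kappa> * (cmod (?W v))\<^sup>2" for v
  proof -
    define p where "p = c * v + b"
    have p: "cnj A * p = A * v + B - cnj D"
      using A by (simp add: p_def c_def b_def field_simps)
    have p': "A * cnj p = cnj A * cnj v + cnj B - D"
      using arg_cong[OF p, of cnj] by simp
    have rel': "cnj D * (1 - A) = B * (1 - cnj A)"
      using arg_cong[OF rel, of cnj] by simp
    \<comment> \<open>After clearing denominators this is a polynomial identity in which each
      variable and its conjugate count as independent, so the relations for \<open>p\<close> and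
      \<open>D\<close> enter together with their conjugates.\<close>
    have "(A * cnj A) * (v * cnj v - p * cnj p + (cnj B * p + B * cnj p))
        = (A * cnj A) * (D * v + cnj D * cnj v) + (B * cnj B - D * cnj D)"
      using p p' rel rel' by algebra
    then have "v * cnj v - p * cnj p + (cnj B * p + B * cnj p)
        = D * v + cnj D * cnj v + (B * cnj B - D * cnj D) / (A * cnj A)"
      using A by (simp add: field_simps)
    then have "complex_of_real ((cmod v)\<^sup>2 - (cmod p)\<^sup>2 + 2 * Re (cnj B * p))
        = of_real (2 * Re (D * v) + ((cmod B)\<^sup>2 - (cmod D)\<^sup>2) / (cmod A)\<^sup>2)"
      unfolding of_real_add of_real_diff of_real_divide complex_norm_square two_Re by simp
    then have e: "(cmod v)\<^sup>2 - (cmod p)\<^sup>2 + 2 * Re (cnj B * p)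
        = 2 * Re (D * v) + ((cmod B)\<^sup>2 - (cmod D)\<^sup>2) / (cmod A)\<^sup>2"
      by (simp only: of_real_eq_iff)
    have arg: "cnj A * p + cnj D = A * v + B" using p by simp
    have "exp ((cmod v)\<^sup>2 - (cmod p)\<^sup>2) * (cmod (?H p))\<^sup>2
        = exp ((cmod v)\<^sup>2 - (cmod p)\<^sup>2 + 2 * Re (cnj B * p)) * ((cmod C)\<^sup>2 * (cmod (f (A * v + B)))\<^sup>2)"
      unfolding affine_comp_def arg
      by (simp add: norm_mult power_mult_distrib exp_add exp_double del: Re_complex_of_real times_complex.sel)
    also have "\<dots> = \<kappa> * (cmod (?W v))\<^sup>2"
      unfolding e affine_comp_def \<kappa>_def
      by (simp add: norm_mult power_mult_distrib exp_add exp_double del: times_complex.sel)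
    finally show ?thesis by (simp add: p_def)
  qed
  have \<kappa>: "\<kappa> \<noteq> 0" by (simp add: \<kappa>_def)
  have "integrable fock_measure (\<lambda>z. (cmod (?H z))\<^sup>2) \<longleftrightarrow> integrable fock_measure (\<lambda>v. \<kappa> * (cmod (?W v))\<^sup>2)"
    using fock_change_of_variables(1)[of "\<lambda>z. (cmod (?H z))\<^sup>2" c b] c unfolding key by simp
  also have "\<dots> \<longleftrightarrow> integrable fock_measure (\<lambda>v. (cmod (?W v))\<^sup>2)"
    using \<kappa> by simp
  finally show "?H \<in> fock_space \<longleftrightarrow> ?W \<in> fock_space"
    using hol by (simp add: fock_space_def)
  show "(fock_norm ?H)\<^sup>2 = exp (((cmod B)\<^sup>2 - (cmod D)\<^sup>2) / (cmod A)\<^sup>2) * (fock_norm ?W)\<^sup>2"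
    using fock_change_of_variables(2)[of "\<lambda>z. (cmod (?H z))\<^sup>2" c b] c unfolding key
    by (simp add: fock_norm_square \<kappa>_def)
qed

section \<open>The adjoint identity, by the modulus of the linear part\<close>

interpretation fock_pair: pair_sigma_finite fock_measure fock_measure ..

text \<open>Writing the values of \<open>g\<close> and of \<open>f\<close> by the reproducing
  formula turns both sides into iterated integrals of the same \<Phi>, in opposite orders.\<close>

lemma affine_comp_adjoint_contractive:
  assumes f: "f \<in> fock_space" and g: "g \<in> fock_space" and A: "cmod A < 1"
  shows "fock_inner (affine_comp A B C D g) f = fock_inner g (affine_comp (cnj A) (cnj D) (cnj C) (cnj B) f)"
proof -
  define \<Phi> where "\<Phi> z u = g z * cnj (f u) * (C * exp (B * cnj z) * exp ((A * cnj z + D) * u))" for z u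
  note [measurable] = fock_spaceD(2)[OF f] fock_spaceD(2)[OF g]
  have meas: "case_prod \<Phi> \<in> borel_measurable (fock_measure \<Otimes>\<^sub>M fock_measure)"
    unfolding \<Phi>_def by measurable
  \<comment> \<open>The pointwise bounds on \<open>f\<close> and \<open>g\<close> contribute 1/2 to
    the coefficient of the square, and the cross term \<open>cmod A * cmod z * cmod u\<close>
    contributes \<open>cmod A / 2\<close> in each variable. The sum is below 1 exactly because
    \<open>cmod A < 1\<close>.\<close>
  define \<epsilon> where "\<epsilon> = (1 + cmod A) / 2"
  have \<epsilon>: "\<epsilon> < 1" using A by (simp add: \<epsilon>_def)
  define K where "K = fock_norm g * fock_norm f * cmod C"
  define E where "E b z = exp (\<epsilon> * (cmod z)\<^sup>2 + b * cmod z)" for b z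
  have E: "integrable fock_measure (E b)" for b
    using fock_integrable_gaussian[OF \<epsilon>] unfolding E_def .
  have bound: "cmod (\<Phi> z u) \<le> K * (E (cmod B) z * E (cmod D) u)" for z u
  proof -
    have 1: "cmod (exp (B * cnj z)) \<le> exp (cmod B * cmod z)"
      using cmod_exp_le[of "B * cnj z"] by (simp add: norm_mult)
    have "cmod ((A * cnj z + D) * u) \<le> cmod A * (cmod z * cmod u) + cmod D * cmod u"
      using norm_triangle_ineq[of "A * cnj z * u" "D * u"] by (simp add: norm_mult algebra_simps)
    also have "cmod z * cmod u \<le> ((cmod z)\<^sup>2 + (cmod u)\<^sup>2) / 2"
      using sum_squares_bound[of "cmod z" "cmod u"] by simp
    finally have "cmod ((A * cnj z + D) * u) \<le> cmod A * (((cmod z)\<^sup>2 + (cmod u)\<^sup>2) / 2) + cmod D * cmod u"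
      by (simp add: mult_left_mono)
    then have 2: "cmod (exp ((A * cnj z + D) * u)) \<le> exp (cmod A * (((cmod z)\<^sup>2 + (cmod u)\<^sup>2) / 2) + cmod D * cmod u)"
      by (intro order_trans[OF cmod_exp_le]) simp
    have "cmod (\<Phi> z u) = cmod (g z) * cmod (f u) * (cmod C * cmod (exp (B * cnj z)) * cmod (exp ((A * cnj z + D) * u)))"
      by (simp only: \<Phi>_def norm_mult complex_mod_cnj)
    also have "\<dots> \<le> (fock_norm g * exp ((cmod z)\<^sup>2 / 2)) * (fock_norm f * exp ((cmod u)\<^sup>2 / 2)) *
        (cmod C * exp (cmod B * cmod z) * exp (cmod A * (((cmod z)\<^sup>2 + (cmod u)\<^sup>2) / 2) + cmod D * cmod u))"
      by (intro mult_mono fock_pointwise_bound f g 1 2 mult_nonneg_nonneg order_refl) auto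
    also have "\<dots> = K * (E (cmod B) z * E (cmod D) u)"
      unfolding K_def E_def \<epsilon>_def by (simp add: exp_add[symmetric] field_simps)
    finally show ?thesis .
  qed
  have dom: "integrable (fock_measure \<Otimes>\<^sub>M fock_measure) (\<lambda>(z, u). K * (E (cmod B) z * E (cmod D) u))"
  proof (rule fock_pair.Fubini_integrable)
    have [measurable]: "E b \<in> borel_measurable borel" for b unfolding E_def by measurable
    show "(\<lambda>(z, u). K * (E (cmod B) z * E (cmod D) u)) \<in> borel_measurable (fock_measure \<Otimes>\<^sub>M fock_measure)"
      by measurable
    show "integrable fock_measure (\<lambda>z. \<integral>u. norm (case (z, u) of (z, u) \<Rightarrow> K * (E (cmod B) z * E (cmod D) u)) \<partial>fock_measure)"
      using E[of "cmod B"] E[of "cmod D"] by (simp add: abs_mult integrable_abs)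
    show "AE z in fock_measure. integrable fock_measure (\<lambda>u. case (z, u) of (z, u) \<Rightarrow> K * (E (cmod B) z * E (cmod D) u))"
      using E[of "cmod D"] by simp
  qed
  have int: "integrable (fock_measure \<Otimes>\<^sub>M fock_measure) (case_prod \<Phi>)"
  proof (rule Bochner_Integration.integrable_bound[OF dom meas])
    have "cmod (\<Phi> z u) \<le> \<bar>K * (E (cmod B) z * E (cmod D) u)\<bar>" for z u
      using bound[of z u] by linarith
    then show "AE x in fock_measure \<Otimes>\<^sub>M fock_measure.
      norm (case_prod \<Phi> x) \<le> norm (case x of (z, u) \<Rightarrow> K * (E (cmod B) z * E (cmod D) u))"
      by (auto intro!: AE_I2)
  qed
  have "(\<integral>u. \<Phi> z u \<partial>fock_measure) = g z * cnj (affine_comp (cnj A) (cnj D) (cnj C) (cnj B) f z)" for z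
  proof -
    have "cnj (f (cnj A * z + cnj D)) = fock_inner (fock_kernel (cnj A * z + cnj D)) f"
      by (subst fock_inner_cnj) (simp add: fock_inner_kernel f)
    also have "\<dots> = (\<integral>u. exp ((A * cnj z + D) * u) * cnj (f u) \<partial>fock_measure)"
      by (simp add: fock_inner_def fock_kernel_def mult.commute)
    finally have "g z * (C * exp (B * cnj z)) * cnj (f (cnj A * z + cnj D))
        = (\<integral>u. g z * (C * exp (B * cnj z)) * (exp ((A * cnj z + D) * u) * cnj (f u)) \<partial>fock_measure)"
      by simp
    from this[symmetric] show ?thesis
      by (simp add: \<Phi>_def affine_comp_def exp_cnj mult_ac)
  qed
  then have 1: "fock_inner g (affine_comp (cnj A) (cnj D) (cnj C) (cnj B) f) = (\<integral>z. \<integral>u. \<Phi> z u \<partial>fock_measure \<partial>fock_measure)"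
    by (simp add: fock_inner_def)
  have "(\<integral>z. \<Phi> z u \<partial>fock_measure) = affine_comp A B C D g u * cnj (f u)" for u
  proof -
    have "g (A * u + B) = (\<integral>z. g z * exp (cnj z * (A * u + B)) \<partial>fock_measure)"
      using fock_inner_kernel[OF g, of "A * u + B"] by (simp add: fock_inner_def fock_kernel_def exp_cnj)
    then have "(cnj (f u) * (C * exp (D * u))) * g (A * u + B)
        = (\<integral>z. (cnj (f u) * (C * exp (D * u))) * (g z * exp (cnj z * (A * u + B))) \<partial>fock_measure)"
      by simp
    moreover have "(cnj (f u) * (C * exp (D * u))) * (g z * exp (cnj z * (A * u + B))) = \<Phi> z u" for z
    proof -
      have "exp (D * u) * exp (cnj z * (A * u + B)) = exp (B * cnj z) * exp ((A * cnj z + D) * u)"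
        by (simp add: algebra_simps flip: exp_add)
      then show ?thesis unfolding \<Phi>_def by (simp add: mult_ac)
    qed
    ultimately have "(cnj (f u) * (C * exp (D * u))) * g (A * u + B) = (\<integral>z. \<Phi> z u \<partial>fock_measure)"
      by (simp only:)
    then show ?thesis by (simp add: affine_comp_def mult_ac)
  qed
  then have 2: "fock_inner (affine_comp A B C D g) f = (\<integral>u. \<integral>z. \<Phi> z u \<partial>fock_measure \<partial>fock_measure)"
    by (simp add: fock_inner_def)
  show ?thesis
    unfolding 1 2 using fock_pair.Fubini_integral[OF int] .
qed

text \<open>The inverse of the operator has the same form with linear part \<open>1 / A\<close>, and
  its formal adjoint inverts the formal adjoint. The contractive case, applied to the two images in
  place of \<open>g\<close> and \<open>f\<close>, is the claim read backwards.\<close>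

lemma affine_comp_adjoint_expansive:
  assumes f: "affine_comp (cnj A) (cnj D) (cnj C) (cnj B) f \<in> fock_space"
    and g: "affine_comp A B C D g \<in> fock_space" and A: "cmod A > 1" and C: "C \<noteq> 0"
  shows "fock_inner (affine_comp A B C D g) f = fock_inner g (affine_comp (cnj A) (cnj D) (cnj C) (cnj B) f)"
proof -
  define A' where "A' = 1 / A"
  define B' where "B' = - B / A"
  \<comment> \<open>The exponential cancels the constant \<open>exp (D * B')\<close> that arises
    when the weight is evaluated at \<open>A' * z + B'\<close>.\<close>
  define C' where "C' = exp (D * B / A) / C"
  define D' where "D' = - D / A"
  have A0: "A \<noteq> 0" using A by auto
  have "affine_comp A' B' C' D' (affine_comp A B C D g) = g"
  proof
    fix z
    have "A * (A' * z + B') + B = z" using A0 by (simp add: A'_def B'_def field_simps)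
    moreover have "exp (D * B / A) * exp (D' * z) * exp (D * (A' * z + B')) = 1"
      using A0 by (simp add: A'_def B'_def D'_def field_simps flip: exp_add)
    ultimately show "affine_comp A' B' C' D' (affine_comp A B C D g) z = g z"
      using C by (simp add: affine_comp_def C'_def field_simps)
  qed
  moreover have "affine_comp (cnj A') (cnj D') (cnj C') (cnj B') (affine_comp (cnj A) (cnj D) (cnj C) (cnj B) f) = f"
  proof
    fix z
    have "cnj A * (cnj A' * z + cnj D') + cnj D = z" using A0 by (simp add: A'_def D'_def field_simps)
    moreover have "exp (cnj (D * B / A)) * exp (cnj B' * z) * exp (cnj B * (cnj A' * z + cnj D')) = 1"
      using A0 by (simp add: A'_def B'_def D'_def field_simps flip: exp_add)
    ultimately show "affine_comp (cnj A') (cnj D') (cnj C') (cnj B') (affine_comp (cnj A) (cnj D) (cnj C) (cnj B) f) z = f z"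
      using C by (simp add: affine_comp_def C'_def exp_cnj field_simps)
  qed
  moreover have "cmod A' < 1"
    using A less_trans[OF zero_less_one A] by (simp add: A'_def norm_divide divide_less_eq)
  ultimately show ?thesis
    using affine_comp_adjoint_contractive[OF f g, of A' B' C' D'] by simp
qed

text \<open>Outside a large disc \<open>g\<close> has small norm, so Cauchy-Schwarz bounds that part
  uniformly in \<open>n\<close>. Inside the disc the norm bound gives a uniform pointwise bound on
  \<open>k n\<close>, and dominated convergence applies.\<close>

lemma fock_weak_null:
  assumes g: "g \<in> fock_space" and k: "\<And>n. k n \<in> fock_space"
    and bd: "\<And>n. fock_norm (k n) \<le> M" and lim: "\<And>z. (\<lambda>n. k n z) \<longlonglongrightarrow> 0"
  shows "(\<lambda>n. fock_inner g (k n)) \<longlonglongrightarrow> 0"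
proof (rule LIMSEQ_I)
  fix e :: real assume e: "e > 0"
  note [measurable] = fock_spaceD(2)[OF g] fock_spaceD(2)[OF k]
  have M0: "M \<ge> 0" using fock_norm_nonneg[of "k 0"] bd[of 0] by linarith
  \<comment> \<open>The tail of \<open>g\<close>. Its complement \<open>g z - G R z\<close> vanishes
    for \<open>cmod z > R\<close>.\<close>
  define G where "G R z = indicator {z. cmod z > R} z *\<^sub>R g z" for R z
  have [measurable]: "G R \<in> borel_measurable borel" for R unfolding G_def by measurable
  have Gint: "integrable fock_measure (\<lambda>z. (cmod (G R z))\<^sup>2)" for R
    by (rule Bochner_Integration.integrable_bound[OF fock_spaceD(3)[OF g]])
      (auto simp: G_def indicator_def)
  have "(\<lambda>m. \<integral>z. (cmod (G (real m) z))\<^sup>2 \<partial>fock_measure) \<longlonglongrightarrow> (\<integral>z. 0 \<partial>fock_measure)"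
  proof (rule integral_dominated_convergence[where w = "\<lambda>z. (cmod (g z))\<^sup>2"])
    show "AE z in fock_measure. (\<lambda>m. (cmod (G (real m) z))\<^sup>2) \<longlonglongrightarrow> 0"
    proof (rule AE_I2)
      fix z
      obtain m0 where "cmod z \<le> real m0" using real_arch_simple by blast
      then have "\<forall>m\<ge>m0. (cmod (G (real m) z))\<^sup>2 = 0" by (auto simp: G_def)
      then show "(\<lambda>m. (cmod (G (real m) z))\<^sup>2) \<longlonglongrightarrow> 0"
        by (intro tendsto_eventually) (auto simp: eventually_sequentially)
    qed
  qed (use fock_spaceD(3)[OF g] in \<open>auto simp: G_def indicator_def\<close>)
  then have "(\<lambda>m. fock_norm (G (real m)) * M) \<longlonglongrightarrow> 0"
    unfolding fock_norm_eq using tendsto_real_sqrt tendsto_mult_left_zero by fastforce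
  then obtain m where m: "fock_norm (G (real m)) * M < e / 2"
    using order_tendstoD(2)[of _ 0 sequentially "e / 2"] e
    by (meson eventually_happens' half_gt_zero sequentially_bot)
  define R where "R = real m"
  let ?I = "\<lambda>n z. (g z - G R z) * cnj (k n z)"
  have one: "(\<lambda>z. 1) \<in> fock_space" using fock_space_power[of 0] by simp
  have gint: "integrable fock_measure (\<lambda>z. cmod (g z) * (M * exp (R\<^sup>2 / 2)))"
    using integrable_norm[OF fock_inner_integrable[OF g one]] by simp
  have Ibd: "cmod (?I n z) \<le> cmod (g z) * (M * exp (R\<^sup>2 / 2))" for n z
  proof (cases "cmod z > R")
    case True then show ?thesis using M0 by (simp add: G_def)
  next
    case False
    have "cmod (k n z) \<le> fock_norm (k n) * exp ((cmod z)\<^sup>2 / 2)" by (rule fock_pointwise_bound[OF k])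
    also have "\<dots> \<le> M * exp (R\<^sup>2 / 2)"
      using False bd[of n] M0 by (intro mult_mono) (auto intro!: power_mono simp: R_def)
    finally show ?thesis
      using False by (simp add: G_def norm_mult mult_left_mono)
  qed
  have Iint: "integrable fock_measure (?I n)" for n
    by (rule Bochner_Integration.integrable_bound[OF gint]) (auto intro!: AE_I2 order_trans[OF Ibd])
  have "(\<lambda>n. \<integral>z. ?I n z \<partial>fock_measure) \<longlonglongrightarrow> (\<integral>z. 0 \<partial>fock_measure)"
  proof (rule integral_dominated_convergence[OF _ _ gint])
    show "AE z in fock_measure. (\<lambda>n. ?I n z) \<longlonglongrightarrow> 0"
    proof (rule AE_I2)
      fix z
      have "(\<lambda>n. ?I n z) \<longlonglongrightarrow> (g z - G R z) * cnj 0"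
        by (intro tendsto_intros lim)
      then show "(\<lambda>n. ?I n z) \<longlonglongrightarrow> 0" by simp
    qed
    show "AE z in fock_measure. norm (?I n z) \<le> cmod (g z) * (M * exp (R\<^sup>2 / 2))" for n
      using Ibd by simp
  qed measurable
  then obtain n0 where n0: "\<And>n. n \<ge> n0 \<Longrightarrow> cmod (\<integral>z. ?I n z \<partial>fock_measure) < e / 2"
    using LIMSEQ_D[of "\<lambda>n. \<integral>z. ?I n z \<partial>fock_measure" 0 "e / 2"] e by auto
  have "norm (fock_inner g (k n) - 0) < e" if "n \<ge> n0" for n
  proof -
    have GI: "integrable fock_measure (\<lambda>z. G R z * cnj (k n z))"
      and Gle: "cmod (fock_inner (G R) (k n)) \<le> fock_norm (G R) * fock_norm (k n)"
      using fock_Cauchy_Schwarz[of "G R" "k n"] Gint fock_spaceD(3)[OF k] by auto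
    have "fock_inner g (k n) = (\<integral>z. ?I n z + G R z * cnj (k n z) \<partial>fock_measure)"
      by (simp add: fock_inner_def algebra_simps)
    also have "\<dots> = (\<integral>z. ?I n z \<partial>fock_measure) + fock_inner (G R) (k n)"
      unfolding fock_inner_def by (rule Bochner_Integration.integral_add[OF Iint GI])
    finally have "cmod (fock_inner g (k n)) \<le> cmod (\<integral>z. ?I n z \<partial>fock_measure) + fock_norm (G R) * fock_norm (k n)"
      using norm_triangle_ineq[of "\<integral>z. ?I n z \<partial>fock_measure" "fock_inner (G R) (k n)"] Gle by simp
    also have "fock_norm (G R) * fock_norm (k n) \<le> fock_norm (G R) * M"
      by (rule mult_left_mono[OF bd]) simp
    finally show ?thesis using n0[OF that] m by (simp add: R_def)
  qed
  then show "\<exists>no. \<forall>n\<ge>no. norm (fock_inner g (k n) - 0) < e" by blast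
qed

lemma fock_norm_diff_le:
  assumes "f \<in> fock_space" "g \<in> fock_space"
  shows "(fock_norm (\<lambda>z. f z - g z))\<^sup>2 \<le> 2 * (fock_norm f)\<^sup>2 + 2 * (fock_norm g)\<^sup>2"
proof -
  have "(cmod (f z - g z))\<^sup>2 \<le> 2 * (cmod (f z))\<^sup>2 + 2 * (cmod (g z))\<^sup>2" for z
  proof -
    have "(cmod (f z - g z))\<^sup>2 \<le> (cmod (f z) + cmod (g z))\<^sup>2"
      by (intro power_mono norm_triangle_ineq4) simp
    also have "\<dots> \<le> 2 * (cmod (f z))\<^sup>2 + 2 * (cmod (g z))\<^sup>2"
      using sum_squares_bound[of "cmod (f z)" "cmod (g z)"] by (simp add: power2_sum)
    finally show ?thesis .
  qed
  then have "(fock_norm (\<lambda>z. f z - g z))\<^sup>2 \<le> (\<integral>z. 2 * (cmod (f z))\<^sup>2 + 2 * (cmod (g z))\<^sup>2 \<partial>fock_measure)"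
    unfolding fock_norm_square using assms by (intro integral_mono') (auto simp: fock_spaceD)
  also have "\<dots> = 2 * (fock_norm f)\<^sup>2 + 2 * (fock_norm g)\<^sup>2"
    using assms by (simp add: fock_spaceD fock_norm_square)
  finally show ?thesis .
qed

lemma fock_weak_convergence:
  assumes g: "g \<in> fock_space" and h: "h \<in> fock_space" and X: "\<And>n. X n \<in> fock_space"
    and bd: "\<And>n. (fock_norm (X n))\<^sup>2 \<le> M" and lim: "\<And>z. (\<lambda>n. X n z) \<longlonglongrightarrow> h z"
  shows "(\<lambda>n. fock_inner g (X n)) \<longlonglongrightarrow> fock_inner g h"
proof -
  have "(\<lambda>n. fock_inner g (\<lambda>z. X n z - h z)) \<longlonglongrightarrow> 0"
  proof (rule fock_weak_null[OF g])
    show "(\<lambda>z. X n z - h z) \<in> fock_space" for n by (rule fock_space_diff[OF X h])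
    have "(fock_norm (\<lambda>z. X n z - h z))\<^sup>2 \<le> 2 * M + 2 * (fock_norm h)\<^sup>2" for n
      using fock_norm_diff_le[OF X h, of n] bd[of n] by linarith
    then show "fock_norm (\<lambda>z. X n z - h z) \<le> sqrt (2 * M + 2 * (fock_norm h)\<^sup>2)" for n
      by (rule real_le_rsqrt)
    show "(\<lambda>n. X n z - h z) \<longlonglongrightarrow> 0" for z
      using lim LIM_zero by blast
  qed
  then show ?thesis
    using g h X by (simp add: fock_inner_diff_right LIM_zero_iff)
qed

text \<open>Supplies a majorant independent of the dilation \<open>s\<close>. The exponent is
  \<open>2 * s * y - s\<^sup>2 * x\<^sup>2 - k\<close> with \<open>x = cmod p\<close> and
  \<open>y = Re (a * p)\<close>. For \<open>y \<le> 0\<close> the pure Gaussian dominates; for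
  \<open>y > 0\<close> the exponent exceeds its value at \<open>s = 1\<close> by at most
  \<open>(cmod a)\<^sup>2\<close>.\<close>

lemma shifted_gaussian_dilation_bound:
  fixes p d D :: complex and s :: real
  assumes "1 \<le> s" "s \<le> 2"
  defines "a \<equiv> cnj d + D" and "k \<equiv> (cmod d)\<^sup>2 + 2 * Re (D * d)"
  shows "exp (2 * Re (D * (s * p - d)) - (cmod (s * p - d))\<^sup>2)
    \<le> exp (\<bar>k\<bar> + (cmod a)\<^sup>2) * (exp (- (cmod p)\<^sup>2) + exp (2 * Re (D * (p - d)) - (cmod (p - d))\<^sup>2))"
proof -
  have expand: "2 * Re (D * (t * p - d)) - (cmod (t * p - d))\<^sup>2 = 2 * t * Re (a * p) - t\<^sup>2 * (cmod p)\<^sup>2 - k" for t :: real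
    by (simp add: a_def k_def cmod_power2) (simp add: power2_eq_square algebra_simps)
  define x where "x = cmod p"
  define y where "y = Re (a * p)"
  have x0: "x \<ge> 0" by (simp add: x_def)
  have y: "y \<le> cmod a * x" unfolding x_def y_def norm_mult[symmetric] by (rule complex_Re_le_cmod)
  let ?E = "\<lambda>t::real. 2 * t * y - t\<^sup>2 * x\<^sup>2 - k"
  have "?E s \<le> \<bar>k\<bar> + (cmod a)\<^sup>2 - x\<^sup>2 \<or> ?E s \<le> \<bar>k\<bar> + (cmod a)\<^sup>2 + ?E 1"
  proof (cases "y \<le> 0")
    case True
    then have "2 * s * y \<le> 0" using assms by (simp add: mult_nonneg_nonpos)
    moreover have "1 * x\<^sup>2 \<le> s\<^sup>2 * x\<^sup>2" using assms by (intro mult_right_mono) auto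
    ultimately show ?thesis using zero_le_power2[of "cmod a"] by (intro disjI1) linarith
  next
    case False
    have "?E s - ?E 1 = (s - 1) * (2 * y - (s + 1) * x\<^sup>2)"
      by (simp add: power2_eq_square algebra_simps)
    also have "\<dots> \<le> (s - 1) * (cmod a)\<^sup>2"
    proof (rule mult_left_mono)
      have "2 * (cmod a * x) \<le> (cmod a)\<^sup>2 + x\<^sup>2"
        using sum_squares_bound[of "cmod a" x] by simp
      moreover have "1 * x\<^sup>2 \<le> (s + 1) * x\<^sup>2" using assms by (intro mult_right_mono) auto
      ultimately show "2 * y - (s + 1) * x\<^sup>2 \<le> (cmod a)\<^sup>2" using y by linarith
    qed (use assms in simp)
    also have "\<dots> \<le> 1 * (cmod a)\<^sup>2" using assms by (intro mult_right_mono) auto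
    finally show ?thesis by (intro disjI2) linarith
  qed
  then have "exp (?E s) \<le> exp (\<bar>k\<bar> + (cmod a)\<^sup>2) * (exp (- x\<^sup>2) + exp (?E 1))"
  proof
    assume "?E s \<le> \<bar>k\<bar> + (cmod a)\<^sup>2 - x\<^sup>2"
    then have "exp (?E s) \<le> exp (\<bar>k\<bar> + (cmod a)\<^sup>2) * exp (- x\<^sup>2)" by (simp flip: exp_add)
    then show ?thesis by (rule order_trans) simp
  next
    assume "?E s \<le> \<bar>k\<bar> + (cmod a)\<^sup>2 + ?E 1"
    then have "exp (?E s) \<le> exp (\<bar>k\<bar> + (cmod a)\<^sup>2) * exp (?E 1)" unfolding exp_add[symmetric] by simp
    then show ?thesis by (rule order_trans) simp
  qed
  then show ?thesis
    using expand[of s] expand[of 1] by (simp add: x_def y_def)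
qed

text \<open>Provides the norm bound needed for weak convergence as \<open>r\<close> tends to 1. A
  substitution with factor \<open>s = 1 / r\<close> makes the argument of \<open>f\<close>
  independent of \<open>r\<close>; only a Gaussian factor still varies, and the preceding majorant
  controls it.\<close>

lemma affine_comp_dilation_bounded:
  fixes A B C D :: complex
  assumes f: "f \<in> fock_space" and Hf: "affine_comp A B C D f \<in> fock_space" and A: "cmod A = 1"
  shows "\<exists>M. \<forall>r\<in>{1/2..1::real}. affine_comp (r * A) (r * B) C D f \<in> fock_space
    \<and> (fock_norm (affine_comp (r * A) (r * B) C D f))\<^sup>2 \<le> M"
proof -
  define d where "d = B / A"
  have A0: "A \<noteq> 0" using A by auto
  define K where "K = exp (\<bar>(cmod d)\<^sup>2 + 2 * Re (D * d)\<bar> + (cmod (cnj d + D))\<^sup>2)"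
  \<comment> \<open>The two summands match those of the majorant: the first integrates to a multiple
    of the squared norm of \<open>f\<close>, the second to the squared norm of its image.\<close>
  define G where "G z = (cmod C)\<^sup>2 * (exp ((cmod z)\<^sup>2 - (cmod (A * z + B))\<^sup>2) *\<^sub>R (cmod (f (A * z + B)))\<^sup>2)
    + (cmod (affine_comp A B C D f z))\<^sup>2" for z
  note [measurable] = fock_spaceD(2)[OF f] fock_spaceD(2)[OF Hf]
  have Gint: "integrable fock_measure G"
    unfolding G_def using fock_change_of_variables(1)[of "\<lambda>z. (cmod (f z))\<^sup>2" A B] A0
      fock_spaceD(3)[OF f] fock_spaceD(3)[OF Hf]
    by (intro Bochner_Integration.integrable_add integrable_mult_right) auto
  have "affine_comp (r * A) (r * B) C D f \<in> fock_space
    \<and> (fock_norm (affine_comp (r * A) (r * B) C D f))\<^sup>2 \<le> 4 * (K * (\<integral>z. G z \<partial>fock_measure))"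
    if r: "r \<in> {1/2..1}" for r :: real
  proof -
    let ?F = "affine_comp (r * A) (r * B) C D f"
    define s where "s = 1 / r"
    have s: "1 \<le> s" "s \<le> 2" "s \<noteq> 0" "r * s = 1" using r by (auto simp: s_def field_simps)
    have hol: "?F holomorphic_on UNIV" using fock_spaceD(1)[OF f] by (rule affine_comp_holomorphic)
    note [measurable] = holomorphic_borel_measurable[OF hol]
    \<comment> \<open>With this \<open>b\<close> the map \<open>s * z + b\<close> is the dilation
      about \<open>- d\<close>, the zero of \<open>A * z + B\<close>.\<close>
    define b where "b = complex_of_real (s - 1) * d"
    let ?L = "\<lambda>z :: complex. exp ((cmod z)\<^sup>2 - (cmod (s * z + b))\<^sup>2) *\<^sub>R (cmod (?F (s * z + b)))\<^sup>2"
    have le: "?L z \<le> K * G z" for z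
    proof -
      define p where "p = z + d"
      have sp: "s * z + b = s * p - d" by (simp add: b_def p_def algebra_simps)
      have AB: "A * z + B = A * p" using A0 by (simp add: p_def d_def field_simps)
      have "r * A * (s * p - d) + r * B = (r * s) *\<^sub>R (A * p) - r * (A * d - B)"
        by (simp add: algebra_simps scaleR_conv_of_real)
      also have "\<dots> = A * p" using s A0 by (simp add: d_def)
      finally have arg: "r * A * (s * p - d) + r * B = A * p" .
      have "?L z = exp ((cmod z)\<^sup>2) * exp (2 * Re (D * (s * p - d)) - (cmod (s * p - d))\<^sup>2)
          * ((cmod C)\<^sup>2 * (cmod (f (A * p)))\<^sup>2)"
        unfolding sp affine_comp_def arg
        by (simp add: norm_mult power_mult_distrib exp_diff exp_double del: times_complex.sel minus_complex.sel)
      also have "\<dots> \<le> exp ((cmod z)\<^sup>2) * (K * (exp (- (cmod p)\<^sup>2) + exp (2 * Re (D * (p - d)) - (cmod (p - d))\<^sup>2)))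
          * ((cmod C)\<^sup>2 * (cmod (f (A * p)))\<^sup>2)"
        unfolding K_def using shifted_gaussian_dilation_bound[OF s(1,2), of D p d]
        by (intro mult_right_mono mult_left_mono) auto
      also have "\<dots> = K * G z"
      proof -
        have "p - d = z" by (simp add: p_def)
        moreover have "cmod (A * p) = cmod p" using A by (simp add: norm_mult)
        ultimately show ?thesis
          unfolding G_def affine_comp_def AB
          by (simp add: norm_mult power_mult_distrib exp_diff exp_double exp_minus field_simps
              del: times_complex.sel minus_complex.sel)
      qed
      finally show ?thesis .
    qed
    have KG: "integrable fock_measure (\<lambda>z. K * G z)" using Gint by simp
    have L0: "?L z \<ge> 0" for z by simp
    have "integrable fock_measure ?L"
    proof (rule Bochner_Integration.integrable_bound[OF KG])
      show "AE z in fock_measure. norm (?L z) \<le> norm (K * G z)"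
        using le L0 by (intro AE_I2) (smt (verit) real_norm_def)
    qed measurable
    then have "integrable fock_measure (\<lambda>z. (cmod (?F z))\<^sup>2)"
      using fock_change_of_variables(1)[of "\<lambda>z. (cmod (?F z))\<^sup>2" "complex_of_real s" b] s by simp
    then have "?F \<in> fock_space" using hol by (simp add: fock_space_def)
    moreover have "(fock_norm ?F)\<^sup>2 = s\<^sup>2 * (\<integral>z. ?L z \<partial>fock_measure)"
      using fock_change_of_variables(2)[of "\<lambda>z. (cmod (?F z))\<^sup>2" "complex_of_real s" b] s
      by (simp add: fock_norm_square)
    moreover have "s\<^sup>2 * (\<integral>z. ?L z \<partial>fock_measure) \<le> 4 * (K * (\<integral>z. G z \<partial>fock_measure))"
    proof (rule mult_mono)
      show "s\<^sup>2 \<le> 4" using power_mono[of s 2 2] s by simp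
      have "(\<integral>z. ?L z \<partial>fock_measure) \<le> (\<integral>z. K * G z \<partial>fock_measure)"
        using KG le order_trans[OF L0 le] by (intro integral_mono')
      then show "(\<integral>z. ?L z \<partial>fock_measure) \<le> K * (\<integral>z. G z \<partial>fock_measure)" by simp
    qed auto
    ultimately show ?thesis by simp
  qed
  then show ?thesis by blast
qed

text \<open>Dilating \<open>f\<close> by \<open>r n < 1\<close> makes the linear part contractive,
  so the contractive case applies twice: once to the dilation, once to its composite with the
  operator. Boundedness and pointwise convergence then allow both inner products to pass to the
  limit.\<close>

lemma affine_comp_adjoint_unimodular:
  assumes f: "f \<in> fock_space" and g: "g \<in> fock_space" and A: "cmod A = 1"
    and Hf: "affine_comp (cnj A) (cnj D) (cnj C) (cnj B) f \<in> fock_space"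
    and Wg: "affine_comp A B C D g \<in> fock_space"
  shows "fock_inner (affine_comp A B C D g) f = fock_inner g (affine_comp (cnj A) (cnj D) (cnj C) (cnj B) f)"
proof -
  let ?W = "affine_comp A B C D g" and ?H = "affine_comp (cnj A) (cnj D) (cnj C) (cnj B) f"
  \<comment> \<open>The summand 2 keeps \<open>r n\<close> at least 1/2 from \<open>n = 0\<close>
    on, the range of \<open>affine_comp_dilation_bounded\<close>.\<close>
  define r where "r n = 1 - 1 / (real n + 2)" for n
  have r: "r n \<in> {1/2..1}" "r n < 1" for n
    by (auto simp: r_def field_simps)
  have r_lim: "r \<longlonglongrightarrow> 1"
    unfolding r_def by real_asymp
  have cont: "isCont f z" for z
    using fock_spaceD(1)[OF f] by (simp add: holomorphic_on_imp_continuous_on continuous_on_interior field_differentiable_imp_continuous_at holomorphic_on_imp_differentiable_at)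
  define F where "F n = affine_comp (r n) 0 1 0 f" for n
  \<comment> \<open>The formal adjoint of the composite with parameters \<open>r n * A\<close>,
    \<open>B\<close>, \<open>C\<close>, \<open>r n * D\<close>.\<close>
  define H where "H n = affine_comp (r n * cnj A) (r n * cnj D) (cnj C) (cnj B) f" for n
  have id: "affine_comp 1 0 1 0 f = f" by (simp add: affine_comp_def fun_eq_iff)
  have "\<exists>M. \<forall>r\<in>{1/2..1::real}. affine_comp r 0 1 0 f \<in> fock_space \<and> (fock_norm (affine_comp r 0 1 0 f))\<^sup>2 \<le> M"
    using affine_comp_dilation_bounded[of f 1 0 1 0] f id by simp
  then obtain M1 where M1: "\<And>n. F n \<in> fock_space \<and> (fock_norm (F n))\<^sup>2 \<le> M1"
    using r(1) unfolding F_def by blast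
  obtain M2 where M2: "\<And>n. H n \<in> fock_space \<and> (fock_norm (H n))\<^sup>2 \<le> M2"
    using affine_comp_dilation_bounded[OF f Hf] A r(1) unfolding H_def complex_mod_cnj by blast
  have eq: "fock_inner ?W (F n) = fock_inner g (H n)" for n
  proof -
    have r1: "cmod (r n) < 1" "cmod (r n * A) < 1" using r[of n] A by (auto simp: norm_mult)
    have "fock_inner ?W (F n) = fock_inner (affine_comp (r n) 0 1 0 ?W) f"
      using affine_comp_adjoint_contractive[OF f Wg r1(1), of 0 1 0] by (simp add: F_def)
    also have "affine_comp (r n) 0 1 0 ?W = affine_comp (r n * A) B C (r n * D) g"
      by (simp add: affine_comp_def fun_eq_iff mult_ac)
    also have "fock_inner \<dots> f = fock_inner g (H n)"
      using affine_comp_adjoint_contractive[OF f g r1(2)] by (simp add: H_def)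
    finally show ?thesis .
  qed
  have rc: "(\<lambda>n. complex_of_real (r n)) \<longlonglongrightarrow> 1"
    using tendsto_of_real[OF r_lim] by simp
  have "(\<lambda>n. fock_inner ?W (F n)) \<longlonglongrightarrow> fock_inner ?W f"
  proof (rule fock_weak_convergence[OF Wg f])
    show "(\<lambda>n. F n z) \<longlonglongrightarrow> f z" for z
      unfolding F_def affine_comp_def
      using isCont_tendsto_compose[OF cont tendsto_mult_right[OF rc, of z]] by (simp add: mult.commute)
  qed (use M1 in auto)
  moreover have "(\<lambda>n. fock_inner g (H n)) \<longlonglongrightarrow> fock_inner g ?H"
  proof (rule fock_weak_convergence[OF g Hf])
    show "(\<lambda>n. H n z) \<longlonglongrightarrow> ?H z" for z
    proof -
      have "(\<lambda>n. r n * cnj A * z + r n * cnj D) \<longlonglongrightarrow> 1 * cnj A * z + 1 * cnj D"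
        by (intro tendsto_intros rc)
      then have "(\<lambda>n. f (r n * cnj A * z + r n * cnj D)) \<longlonglongrightarrow> f (cnj A * z + cnj D)"
        using isCont_tendsto_compose[OF cont] by fastforce
      then show ?thesis unfolding H_def affine_comp_def by (intro tendsto_mult_left)
    qed
  qed (use M2 in auto)
  ultimately show ?thesis unfolding eq by (rule LIMSEQ_unique)
qed

lemma affine_comp_adjoint:
  assumes "f \<in> fock_space" "g \<in> fock_space" "C \<noteq> 0"
    and "affine_comp (cnj A) (cnj D) (cnj C) (cnj B) f \<in> fock_space" "affine_comp A B C D g \<in> fock_space"
  shows "fock_inner (affine_comp A B C D g) f = fock_inner g (affine_comp (cnj A) (cnj D) (cnj C) (cnj B) f)"
  using assms affine_comp_adjoint_contractive affine_comp_adjoint_unimodular affine_comp_adjoint_expansive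
  by (cases "cmod A" "1::real" rule: linorder_cases) auto

section \<open>Cohyponormal weighted composition operators\<close>

text \<open>The difference quotient \<open>q\<close> at 0 is entire and has no zeros. Injectivity
  and the open mapping theorem keep \<open>\<phi> z\<close> away from \<open>\<phi> 0\<close> for
  large \<open>z\<close>, so \<open>1 / q\<close> grows at most linearly. It is therefore a
  polynomial of degree at most one without zeros, that is, a constant.\<close>

lemma entire_injective_imp_affine:
  assumes hol: "\<phi> holomorphic_on UNIV" and inj: "inj \<phi>"
  shows "\<exists>A B. \<forall>z. \<phi> z = A * z + B"
proof -
  define q where "q z = (if z = 0 then deriv \<phi> 0 else (\<phi> z - \<phi> 0) / z)" for z
  \<comment> \<open>The form in which \<open>pole_theorem\<close> removes the singularity at 0; the
    last quotient is zero.\<close>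
  have "(\<lambda>z. if z = 0 then deriv (\<lambda>z. \<phi> z - \<phi> 0) 0 else (\<phi> z - \<phi> 0) / z - (\<phi> 0 - \<phi> 0) / (z - 0)) holomorphic_on UNIV"
    by (rule pole_theorem) (auto intro!: holomorphic_intros hol)
  moreover have "deriv (\<lambda>z. \<phi> z - \<phi> 0) 0 = deriv \<phi> 0"
    using holomorphic_on_imp_differentiable_at[OF hol] by (subst deriv_diff) auto
  then have "(\<lambda>z. if z = 0 then deriv (\<lambda>z. \<phi> z - \<phi> 0) 0 else (\<phi> z - \<phi> 0) / z - (\<phi> 0 - \<phi> 0) / (z - 0)) = q"
    by (auto simp: q_def)
  ultimately have q_hol: "q holomorphic_on UNIV"
    by simp
  have q0: "q z \<noteq> 0" for z
    using injD[OF inj, of z 0] holomorphic_injective_imp_regular[OF hol open_UNIV inj, of 0]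
    by (auto simp: q_def)
  have "open (\<phi> ` ball 0 1)"
    by (rule open_mapping_thm3) (auto intro: holomorphic_on_subset[OF hol] inj_on_subset[OF inj])
  then obtain e where e: "e > 0" "ball (\<phi> 0) e \<subseteq> \<phi> ` ball 0 1"
    unfolding open_contains_ball by (meson centre_in_ball image_eqI zero_less_one)
  have growth: "cmod (1 / q z) \<le> (1 / e) * cmod z ^ 1" if z: "1 \<le> cmod z" for z
  proof -
    have "\<phi> z \<notin> \<phi> ` ball 0 1" using z by (simp add: inj_image_mem_iff[OF inj])
    then have "\<phi> z \<notin> ball (\<phi> 0) e" using e(2) by blast
    then have "e \<le> cmod (\<phi> z - \<phi> 0)" by (simp add: dist_norm norm_minus_commute)
    moreover have "z \<noteq> 0" using z by auto
    ultimately show ?thesis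
      using e(1) by (simp add: q_def norm_divide frac_le)
  qed
  have inv_hol: "(\<lambda>z. 1 / q z) holomorphic_on UNIV"
    using q_hol q0 by (intro holomorphic_intros) auto
  define a where "a k = (deriv ^^ k) (\<lambda>z. 1 / q z) 0 / fact k" for k
  have lin: "1 / q z = a 0 + a 1 * z" for z
    using Liouville_polynomial[OF inv_hol growth, where \<xi> = z] by (simp add: a_def)
  have "a 1 = 0"
  proof (rule ccontr)
    assume "a 1 \<noteq> 0"
    then have "1 / q (- a 0 / a 1) = 0" using lin by simp
    then show False using q0 by simp
  qed
  then have "q z = 1 / a 0" for z
    using lin[of z] q0[of z] by (metis add.right_neutral divide_divide_eq_right mult_zero_left div_by_1 mult_1)
  moreover have "\<phi> z = q z * z + \<phi> 0" for z
    by (simp add: q_def)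
  ultimately have "\<phi> z = (1 / a 0) * z + \<phi> 0" for z
    by metis
  then show ?thesis by blast
qed

section \<open>Domain, closedness and density for weighted composition operators\<close>

lemma fock_norm_scale: "fock_norm (\<lambda>z. c * f z) = cmod c * fock_norm f"
  by (simp add: fock_norm_eq norm_mult power_mult_distrib real_sqrt_mult)

lemma weighted_comp_affine: "weighted_comp (\<lambda>z. C * exp (D * z)) (\<lambda>z. A * z + B) f = affine_comp A B C D f"
  by (simp add: weighted_comp_def affine_comp_def fun_eq_iff)

lemma dom_weighted_comp_max:
  "f \<in> dom (weighted_comp_max \<psi> \<phi>) \<longleftrightarrow> f \<in> fock_space \<and> weighted_comp \<psi> \<phi> f \<in> fock_space"
  by (auto simp: weighted_comp_max_def split: if_splits)

lemma weighted_comp_op_domD: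
  assumes "is_weighted_comp_op \<psi> \<phi> W" "f \<in> dom W"
  shows "f \<in> fock_space" "weighted_comp \<psi> \<phi> f \<in> fock_space" "W f = Some (weighted_comp \<psi> \<phi> f)"
  using assms by (auto simp: is_weighted_comp_op_def weighted_comp_max_def restrict_map_def split: if_splits)

text \<open>Makes \<open>weighted_comp_op_domD\<close> applicable to the maximal operator
  itself.\<close>

lemma is_weighted_comp_op_max: "is_weighted_comp_op \<psi> \<phi> (weighted_comp_max \<psi> \<phi>)"
proof -
  have "fun_subspace (dom (weighted_comp_max \<psi> \<phi>))"
    unfolding fun_subspace_def Ball_def dom_weighted_comp_max
    using fock_space_add[of "weighted_comp \<psi> \<phi> _" "weighted_comp \<psi> \<phi> _"] fock_space_scale[of "weighted_comp \<psi> \<phi> _"]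
    by (auto simp: weighted_comp_def fock_space_zero fock_space_add fock_space_scale distrib_left mult.left_commute)
  moreover have "weighted_comp_max \<psi> \<phi> = weighted_comp_max \<psi> \<phi> |` dom (weighted_comp_max \<psi> \<phi>)"
    by (auto simp: restrict_map_def fun_eq_iff domIff)
  ultimately show ?thesis unfolding is_weighted_comp_op_def by blast
qed

text \<open>Norm convergence implies pointwise convergence, and the formal expression depends on
  pointwise values alone. The two limits therefore agree at every point, and \<open>f\<close> lies
  in the maximal domain because \<open>g\<close> is in the Fock space.\<close>

lemma closed_weighted_comp_max: "closed_op (weighted_comp_max \<psi> \<phi>)"
  unfolding closed_op_def
proof (intro allI ballI impI)
  fix X :: "nat \<Rightarrow> complex \<Rightarrow> complex" and f g
  let ?T = "weighted_comp_max \<psi> \<phi>"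
  assume f: "f \<in> fock_space" and g: "g \<in> fock_space" and X: "\<forall>n. X n \<in> dom ?T"
    and 1: "(\<lambda>n. fock_norm (\<lambda>z. X n z - f z)) \<longlonglongrightarrow> 0"
    and 2: "(\<lambda>n. fock_norm (\<lambda>z. the (?T (X n)) z - g z)) \<longlonglongrightarrow> 0"
  have Xn: "X n \<in> dom ?T" for n using X by blast
  have T: "the (?T (X n)) = weighted_comp \<psi> \<phi> (X n)" "X n \<in> fock_space" "weighted_comp \<psi> \<phi> (X n) \<in> fock_space" for n
    using weighted_comp_op_domD[OF is_weighted_comp_op_max Xn] by simp_all
  have "weighted_comp \<psi> \<phi> f z = g z" for z
  proof (rule LIMSEQ_unique)
    show "(\<lambda>n. weighted_comp \<psi> \<phi> (X n) z) \<longlonglongrightarrow> g z"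
      using fock_norm_convergence_pointwise[OF g T(3)] 2 T(1) by simp
    have "(\<lambda>n. X n (\<phi> z)) \<longlonglongrightarrow> f (\<phi> z)"
      using fock_norm_convergence_pointwise[OF f T(2) 1] .
    then show "(\<lambda>n. weighted_comp \<psi> \<phi> (X n) z) \<longlonglongrightarrow> weighted_comp \<psi> \<phi> f z"
      unfolding weighted_comp_def by (rule tendsto_mult_left)
  qed
  then have "weighted_comp \<psi> \<phi> f = g" by blast
  then show "?T f = Some g" using f g by (simp add: weighted_comp_max_def)
qed

text \<open>Polynomials lie in the maximal domain, and the Taylor polynomials of \<open>f\<close>
  converge to \<open>f\<close> in norm.\<close>

lemma densely_defined_affine_comp:
  "densely_defined (weighted_comp_max (\<lambda>z. C * exp (D * z)) (\<lambda>z. A * z + B))"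
  unfolding densely_defined_def
proof (intro ballI allI impI)
  fix f :: "complex \<Rightarrow> complex" and e :: real
  assume f: "f \<in> fock_space" and e: "e > 0"
  define s where "s N z = (\<Sum>n<N. (deriv ^^ n) f 0 / fact n * z ^ n)" for N z
  have "(\<lambda>N. fock_norm (\<lambda>z. f z - s N z)) \<longlonglongrightarrow> 0"
    unfolding s_def by (rule fock_Taylor_convergence[OF f])
  then obtain N where N: "fock_norm (\<lambda>z. f z - s N z) < e"
    using order_tendstoD(2)[of _ 0 sequentially e] e by (meson eventually_happens' sequentially_bot)
  have "s N \<in> fock_space"
    unfolding s_def by (intro fock_space_sum fock_space_scale fock_space_power)
  moreover have "affine_comp A B C D (s N)
      = (\<lambda>z. \<Sum>n<N. (deriv ^^ n) f 0 / fact n * affine_comp A B C D (\<lambda>z. z ^ n) z)"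
    by (simp add: affine_comp_def s_def fun_eq_iff sum_distrib_left mult_ac)
  then have "affine_comp A B C D (s N) \<in> fock_space"
    by (simp only: fock_space_sum fock_space_scale affine_comp_power_in_fock_space)
  ultimately show "\<exists>g\<in>dom (weighted_comp_max (\<lambda>z. C * exp (D * z)) (\<lambda>z. A * z + B)). fock_norm (\<lambda>z. f z - g z) < e"
    using N by (intro bexI[of _ "s N"]) (auto simp: dom_weighted_comp_max weighted_comp_affine)
qed

section \<open>Sufficiency of the conditions on the symbols\<close>

text \<open>The degenerate case of the norm comparison, where division by \<open>A\<close> is
  impossible. The relation reduces to \<open>D = cnj B\<close>, so the weights and the evaluation
  points agree up to conjugating \<open>C\<close>.\<close>

lemma affine_comp_adjoint_zero:
  assumes "A = 0" and "D * (1 - cnj A) = cnj B * (1 - A)"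
  shows "cmod (affine_comp A B C D f z) = cmod (affine_comp (cnj A) (cnj D) (cnj C) (cnj B) f z)"
  using assms by (simp add: affine_comp_def norm_mult)

lemma affine_comp_adjoint_in_fock_space_iff:
  assumes f: "f \<in> fock_space" and rel: "D * (1 - cnj A) = cnj B * (1 - A)"
  shows "affine_comp (cnj A) (cnj D) (cnj C) (cnj B) f \<in> fock_space \<longleftrightarrow> affine_comp A B C D f \<in> fock_space"
proof (cases "A = 0")
  case True
  then show ?thesis
    using affine_comp_adjoint_zero[OF True rel] affine_comp_holomorphic[OF fock_spaceD(1)[OF f]]
    by (simp add: fock_space_def)
qed (use affine_comp_adjoint_norm(1)[OF fock_spaceD(1)[OF f] _ rel] in simp)

lemma affine_comp_norm_le_adjoint:
  assumes f: "f \<in> fock_space" and rel: "D * (1 - cnj A) = cnj B * (1 - A)" and BD: "cmod D \<le> cmod B"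
  shows "fock_norm (affine_comp A B C D f) \<le> fock_norm (affine_comp (cnj A) (cnj D) (cnj C) (cnj B) f)"
proof (cases "A = 0")
  case True
  then show ?thesis
    using affine_comp_adjoint_zero[OF True rel] by (simp add: fock_norm_eq)
next
  case False
  have "(cmod D)\<^sup>2 \<le> (cmod B)\<^sup>2" using BD by (intro power_mono) auto
  then have "1 \<le> exp (((cmod B)\<^sup>2 - (cmod D)\<^sup>2) / (cmod A)\<^sup>2)" by simp
  then have "1 * (fock_norm (affine_comp A B C D f))\<^sup>2 \<le> (fock_norm (affine_comp (cnj A) (cnj D) (cnj C) (cnj B) f))\<^sup>2"
    unfolding affine_comp_adjoint_norm(2)[OF fock_spaceD(1)[OF f] False rel] by (rule mult_right_mono) simp
  then show ?thesis by (simp add: power2_le_iff_abs_le)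
qed

text \<open>Kernels lie in the domain, and testing the adjoint relation against them forces every
  adjoint value to be given by the formal adjoint. The comparison of domains and norms between the
  operator and its formal adjoint then finishes the proof.\<close>

lemma cohyponormal_affine_comp:
  assumes rel: "D * (1 - cnj A) = cnj B * (1 - A)" and BD: "cmod D \<le> cmod B"
  shows "cohyponormal (weighted_comp_max (\<lambda>z. C * exp (D * z)) (\<lambda>z. A * z + B))"
proof -
  define T where "T = weighted_comp_max (\<lambda>z. C * exp (D * z)) (\<lambda>z. A * z + B)"
  have dense: "densely_defined T" unfolding T_def by (rule densely_defined_affine_comp)
  have dom: "f \<in> dom T \<longleftrightarrow> f \<in> fock_space \<and> affine_comp A B C D f \<in> fock_space" for f
    by (simp add: T_def dom_weighted_comp_max weighted_comp_affine)
  have val: "the (T f) = affine_comp A B C D f" if "f \<in> dom T" for f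
    using weighted_comp_op_domD(3)[OF is_weighted_comp_op_max that[unfolded T_def]]
    by (simp add: T_def weighted_comp_affine)
  have adj: "f \<in> dom T \<and> fock_norm (the (T f)) \<le> fock_norm h" if "adjoint_rel T f h" for f h
  proof -
    have f: "f \<in> fock_space" and h: "h \<in> fock_space" using that by (auto simp: adjoint_rel_def)
    have "h w = affine_comp (cnj A) (cnj D) (cnj C) (cnj B) f w" for w
    proof -
      have K: "fock_kernel w \<in> dom T"
        by (simp add: dom fock_kernel_in_fock_space affine_comp_kernel_in_fock_space)
      have "h w = cnj (fock_inner (fock_kernel w) h)"
        using fock_inner_kernel[OF h] fock_inner_cnj by metis
      also have "fock_inner (fock_kernel w) h = fock_inner (affine_comp A B C D (fock_kernel w)) f"
        using that K val[OF K] unfolding adjoint_rel_def by metis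
      also have "\<dots> = C * exp (B * cnj w) * cnj (f (cnj A * w + cnj D))"
        unfolding affine_comp_kernel[abs_def] fock_inner_scale_left
        using fock_inner_kernel[OF f] fock_inner_cnj by metis
      finally show ?thesis by (simp add: affine_comp_def exp_cnj)
    qed
    then have h_eq: "h = affine_comp (cnj A) (cnj D) (cnj C) (cnj B) f" by blast
    have fT: "f \<in> dom T"
      using affine_comp_adjoint_in_fock_space_iff[OF f rel] h f unfolding h_eq dom by blast
    then show ?thesis
      using affine_comp_norm_le_adjoint[OF f rel BD] by (simp add: val h_eq)
  qed
  have "dom T \<subseteq> fock_space" using dom by blast
  note iff = adjoint_op_eq_Some_iff[OF dense this]
  have "closed_op T" unfolding T_def by (rule closed_weighted_comp_max)
  moreover have "f \<in> dom T" "fock_norm (the (T f)) \<le> fock_norm (the (adjoint_op T f))"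
    if "f \<in> dom (adjoint_op T)" for f
  proof -
    obtain h where h: "adjoint_op T f = Some h" using \<open>f \<in> dom (adjoint_op T)\<close> by blast
    then have "adjoint_rel T f h" by (simp add: iff)
    then show "f \<in> dom T" "fock_norm (the (T f)) \<le> fock_norm (the (adjoint_op T f))"
      using adj[of f h] h by simp_all
  qed
  ultimately show ?thesis
    using dense unfolding cohyponormal_def T_def[symmetric] by blast
qed

section \<open>Necessity: consequences of cohyponormality\<close>

locale cohyponormal_weighted_comp =
  fixes \<psi> \<phi> :: "complex \<Rightarrow> complex" and W :: fock_op
  assumes \<psi>_hol: "\<psi> holomorphic_on UNIV" and \<phi>_hol: "\<phi> holomorphic_on UNIV"
    and \<psi>_nonzero: "\<exists>z. \<psi> z \<noteq> 0"
    and W: "is_weighted_comp_op \<psi> \<phi> W" and coh: "cohyponormal W"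
begin

text \<open>Restates cohyponormality for \<open>adjoint_rel\<close>, so that an explicit adjoint
  pair suffices and the description operator in \<open>adjoint_op\<close> no longer appears.\<close>

lemma dom_adjointD:
  assumes "adjoint_rel W g h"
  shows "g \<in> dom W" "fock_norm (weighted_comp \<psi> \<phi> g) \<le> fock_norm h"
proof -
  have "dom W \<subseteq> fock_space" using weighted_comp_op_domD(1)[OF W] by blast
  then have eq: "adjoint_op W g = Some h"
    using adjoint_op_eq_Some_iff assms coh unfolding cohyponormal_def by blast
  then show g: "g \<in> dom W" using coh unfolding cohyponormal_def by blast
  have "fock_norm (the (W g)) \<le> fock_norm (the (adjoint_op W g))"
    using coh eq unfolding cohyponormal_def by blast
  then show "fock_norm (weighted_comp \<psi> \<phi> g) \<le> fock_norm h"
    using weighted_comp_op_domD(3)[OF W g] eq by simp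
qed

lemma adjoint_kernel:
  "adjoint_rel W (fock_kernel w) (\<lambda>z. cnj (\<psi> w) * fock_kernel (\<phi> w) z)"
  unfolding adjoint_rel_def
proof (intro conjI ballI)
  fix f assume f: "f \<in> dom W"
  show "fock_inner (the (W f)) (fock_kernel w) = fock_inner f (\<lambda>z. cnj (\<psi> w) * fock_kernel (\<phi> w) z)"
    using weighted_comp_op_domD[OF W f]
    by (simp add: fock_inner_kernel fock_inner_scale_right) (simp add: weighted_comp_def)
qed (simp_all add: fock_kernel_in_fock_space fock_space_scale)

lemma kernel_in_dom: "fock_kernel w \<in> dom W"
  using dom_adjointD(1)[OF adjoint_kernel] .

text \<open>Combines the pointwise bound for the image of \<open>fock_kernel w\<close> with the norm
  of its adjoint image. All constraints on \<psi> below come from choices of \<open>z\<close> and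
  \<open>w\<close> here.\<close>

lemma kernel_inequality:
  "cmod (\<psi> z) * exp (Re (\<phi> z * cnj w)) \<le> cmod (\<psi> w) * exp (((cmod (\<phi> w))\<^sup>2 + (cmod z)\<^sup>2) / 2)"
proof -
  have "cmod (\<psi> z) * exp (Re (\<phi> z * cnj w)) = cmod (weighted_comp \<psi> \<phi> (fock_kernel w) z)"
    by (simp add: weighted_comp_def fock_kernel_def norm_mult)
  also have "\<dots> \<le> fock_norm (weighted_comp \<psi> \<phi> (fock_kernel w)) * exp ((cmod z)\<^sup>2 / 2)"
    using weighted_comp_op_domD(2)[OF W kernel_in_dom] by (rule fock_pointwise_bound)
  also have "\<dots> \<le> fock_norm (\<lambda>z. cnj (\<psi> w) * fock_kernel (\<phi> w) z) * exp ((cmod z)\<^sup>2 / 2)"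
    using dom_adjointD(2)[OF adjoint_kernel] by (rule mult_right_mono) simp
  also have "\<dots> = cmod (\<psi> w) * exp (((cmod (\<phi> w))\<^sup>2 + (cmod z)\<^sup>2) / 2)"
    by (simp add: fock_norm_scale fock_norm_kernel add_divide_distrib exp_add)
  finally show ?thesis .
qed

lemma \<psi>_zero_free: "\<psi> w \<noteq> 0"
proof
  assume "\<psi> w = 0"
  then have "cmod (\<psi> z) * exp (Re (\<phi> z * cnj w)) \<le> 0" for z
    using kernel_inequality[of z w] by simp
  then have "\<psi> z = 0" for z
    by (metis exp_gt_zero mult_le_0_iff norm_le_zero_iff not_le)
  then show False using \<psi>_nonzero by blast
qed

text \<open>
  If \<open>\<phi> w = \<phi> w'\<close>, a combination of the two kernels lies in the kernel of the adjoint, hence of \<open>W\<close>.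
\<close>

lemma \<phi>_constant_or_inj: "(\<exists>c. \<forall>z. \<phi> z = c) \<or> inj \<phi>"
proof (rule disjCI)
  assume "\<not> inj \<phi>"
  then obtain w w' where w: "\<phi> w = \<phi> w'" "w \<noteq> w'" by (auto simp: inj_def)
  define x where "x z = cnj (\<psi> w') * fock_kernel w z - cnj (\<psi> w) * fock_kernel w' z" for z
  have x_in: "x \<in> fock_space"
    unfolding x_def by (intro fock_space_diff fock_space_scale fock_kernel_in_fock_space)
  have "adjoint_rel W x (\<lambda>z. 0)"
    unfolding adjoint_rel_def
  proof (intro conjI ballI x_in fock_space_zero)
    fix f assume "f \<in> dom W"
    note f = weighted_comp_op_domD[OF W this]
    have "fock_inner (weighted_comp \<psi> \<phi> f) x
        = \<psi> w' * weighted_comp \<psi> \<phi> f w - \<psi> w * weighted_comp \<psi> \<phi> f w'"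
      unfolding x_def using f(2)
      by (simp add: fock_inner_diff_right fock_space_scale fock_kernel_in_fock_space
          fock_inner_scale_right fock_inner_kernel)
    also have "\<dots> = 0" by (simp add: weighted_comp_def w)
    finally show "fock_inner (the (W f)) x = fock_inner f (\<lambda>z. 0)"
      using f(3) by (simp add: fock_inner_def)
  qed
  note D = dom_adjointD[OF this]
  have "fock_norm (weighted_comp \<psi> \<phi> x) = 0"
    using D(2) fock_norm_nonneg[of "weighted_comp \<psi> \<phi> x"] by (simp add: fock_norm_eq[of "\<lambda>z. 0"])
  then have "weighted_comp \<psi> \<phi> x z = 0" for z
    using fock_norm_zero_imp weighted_comp_op_domD(2)[OF W D(1)] by blast
  then have x0: "x (\<phi> z) = 0" for z
    using \<psi>_zero_free by (simp add: weighted_comp_def)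
  \<comment> \<open>Vanishing of \<open>x\<close> on the range of \<phi> says that
    \<open>exp (\<phi> z * b)\<close> is constant. As \<open>b\<close> is nonzero and the
    exponential has no zeros, the derivative of \<phi> vanishes.\<close>
  define b where "b = cnj w - cnj w'"
  have b: "b \<noteq> 0" using w(2) by (simp add: b_def)
  have const: "exp (\<phi> z * b) = cnj (\<psi> w) / cnj (\<psi> w')" for z
    using x0[of z] \<psi>_zero_free[of w'] by (simp add: x_def fock_kernel_def b_def right_diff_distrib exp_diff field_simps)
  have "(\<phi> has_field_derivative 0) (at z)" for z
  proof -
    have d: "(\<phi> has_field_derivative deriv \<phi> z) (at z)"
      using \<phi>_hol holomorphic_derivI by blast
    have "((\<lambda>z. exp (\<phi> z * b)) has_field_derivative exp (\<phi> z * b) * (deriv \<phi> z * b)) (at z)"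
      by (rule derivative_eq_intros d refl)+ simp
    moreover have "((\<lambda>z. exp (\<phi> z * b)) has_field_derivative 0) (at z)"
      unfolding const by simp
    ultimately have "exp (\<phi> z * b) * (deriv \<phi> z * b) = 0" by (rule DERIV_unique)
    with b d show ?thesis by simp
  qed
  then have "\<exists>c. \<forall>z\<in>UNIV. \<phi> z = c"
    by (intro has_field_derivative_zero_constant) auto
  then show "\<exists>c. \<forall>z. \<phi> z = c" by simp
qed

lemma \<phi>_affine: "\<exists>A B. \<forall>z. \<phi> z = A * z + B"
  using \<phi>_constant_or_inj
proof
  assume "\<exists>c. \<forall>z. \<phi> z = c"
  then obtain c where "\<forall>z. \<phi> z = 0 * z + c" by auto
  then show ?thesis by blast
qed (rule entire_injective_imp_affine[OF \<phi>_hol])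

text \<open>\<psi> has no zeros, so the quotient \<open>G\<close> is entire, and
  \<open>kernel_inequality\<close> bounds it. The equation expresses \<open>G w = G 0\<close>, which
  is Liouville's theorem.\<close>

lemma \<psi>_functional_equation:
  assumes \<phi>: "\<And>z. \<phi> z = A * z + B"
  shows "\<psi> (cnj A * w + k) * exp (cnj B * (1 - A) * w) * \<psi> 0 = \<psi> k * \<psi> w"
proof -
  define G where "G w = \<psi> (cnj A * w + k) / \<psi> w * exp (cnj B * (1 - A) * w)" for w
  have "G holomorphic_on UNIV"
    unfolding G_def using holomorphic_compose_affine[OF \<psi>_hol] \<psi>_hol \<psi>_zero_free
    by (intro holomorphic_intros) auto
  moreover have "cmod (G w) \<le> exp (((cmod k)\<^sup>2 + (cmod B)\<^sup>2) / 2)" for w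
  proof -
    define z where "z = cnj A * w + k"
    \<comment> \<open>With this \<open>z\<close> the terms quadratic in \<open>w\<close> cancel, as
      do the linear terms involving \<open>k\<close>. The exponential factor in \<open>G\<close> is
      chosen to remove the remaining linear term.\<close>
    have "complex_of_real (2 * Re (cnj B * (1 - A) * w) + ((cmod (\<phi> w))\<^sup>2 + (cmod z)\<^sup>2) - 2 * Re (\<phi> z * cnj w))
        = of_real ((cmod k)\<^sup>2 + (cmod B)\<^sup>2)"
      unfolding of_real_add of_real_diff complex_norm_square two_Re \<phi> z_def by (simp add: algebra_simps)
    then have e: "2 * Re (cnj B * (1 - A) * w) + ((cmod (\<phi> w))\<^sup>2 + (cmod z)\<^sup>2) - 2 * Re (\<phi> z * cnj w)
        = (cmod k)\<^sup>2 + (cmod B)\<^sup>2"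
      by (simp only: of_real_eq_iff)
    have "cmod (\<psi> z) \<le> cmod (\<psi> w) * exp (((cmod (\<phi> w))\<^sup>2 + (cmod z)\<^sup>2) / 2 - Re (\<phi> z * cnj w))"
      using kernel_inequality[of z w] by (simp add: exp_diff pos_le_divide_eq del: times_complex.sel)
    then have "cmod (\<psi> z) / cmod (\<psi> w) \<le> exp (((cmod (\<phi> w))\<^sup>2 + (cmod z)\<^sup>2) / 2 - Re (\<phi> z * cnj w))"
      using \<psi>_zero_free[of w] by (simp add: divide_le_eq mult.commute)
    then have "cmod (\<psi> z) / cmod (\<psi> w) * exp (Re (cnj B * (1 - A) * w))
        \<le> exp (((cmod (\<phi> w))\<^sup>2 + (cmod z)\<^sup>2) / 2 - Re (\<phi> z * cnj w)) * exp (Re (cnj B * (1 - A) * w))"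
      by (rule mult_right_mono) simp
    also have "\<dots> = exp (((cmod k)\<^sup>2 + (cmod B)\<^sup>2) / 2)"
      unfolding exp_add[symmetric] e[symmetric] by (rule arg_cong[of _ _ exp]) argo
    finally show ?thesis
      by (simp only: G_def z_def norm_mult norm_divide norm_exp_eq_Re)
  qed
  then have "bounded (range G)" by (auto simp: bounded_iff)
  ultimately have "G constant_on UNIV" by (rule Liouville_theorem)
  then have "G w = G 0" by (auto simp: constant_on_def)
  then show ?thesis
    using \<psi>_zero_free[of 0] \<psi>_zero_free[of w] by (simp add: G_def field_simps)
qed

text \<open>For \<open>A = 0\<close> the functional equation at \<open>k = 0\<close> already gives
  \<psi>. Otherwise its derivative in \<open>w\<close> at 0, with \<open>k\<close> free, is a
  first-order linear differential equation for \<psi>, and its instance at \<open>k = 0\<close>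
  yields the relation between \<open>D\<close> and \<open>B\<close>.\<close>

lemma \<psi>_exponential:
  assumes \<phi>: "\<And>z. \<phi> z = A * z + B"
  shows "\<exists>C D. (\<forall>z. \<psi> z = C * exp (D * z)) \<and> D * (1 - cnj A) = cnj B * (1 - A)"
proof (cases "A = 0")
  case True
  have "\<forall>z. \<psi> z = \<psi> 0 * exp (cnj B * z)"
    using \<psi>_functional_equation[OF \<phi>, of _ 0] True \<psi>_zero_free[of 0] by (simp add: mult.commute)
  moreover have "cnj B * (1 - cnj A) = cnj B * (1 - A)" using True by simp
  ultimately show ?thesis by blast
next
  case False
  define \<beta> where "\<beta> = cnj B * (1 - A)"
  define D where "D = (deriv \<psi> 0 / \<psi> 0 - \<beta>) / cnj A"
  have d: "(\<psi> has_field_derivative deriv \<psi> z) (at z)" for z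
    using \<psi>_hol holomorphic_derivI by blast
  have ode: "deriv \<psi> k = D * \<psi> k" for k
  proof -
    have d1: "(\<psi> has_field_derivative deriv \<psi> k) (at (cnj A * 0 + k))" using d by simp
    have "((\<lambda>w. \<psi> (cnj A * w + k)) has_field_derivative deriv \<psi> k * cnj A) (at 0)"
      by (rule DERIV_chain2[where f = \<psi> and g = "\<lambda>w. cnj A * w + k", OF d1]) (auto intro!: derivative_eq_intros)
    then have "((\<lambda>w. \<psi> (cnj A * w + k) * exp (\<beta> * w) * \<psi> 0) has_field_derivative
        (deriv \<psi> k * cnj A + \<psi> k * \<beta>) * \<psi> 0) (at 0)"
      by (auto intro!: derivative_eq_intros)
    moreover have "((\<lambda>w. \<psi> k * \<psi> w) has_field_derivative \<psi> k * deriv \<psi> 0) (at 0)"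
      using d by (auto intro!: derivative_eq_intros)
    ultimately have "(deriv \<psi> k * cnj A + \<psi> k * \<beta>) * \<psi> 0 = \<psi> k * deriv \<psi> 0"
      unfolding \<psi>_functional_equation[OF \<phi>, folded \<beta>_def] by (rule DERIV_unique)
    then show ?thesis
      using False \<psi>_zero_free[of 0] by (simp add: D_def field_simps)
  qed
  have "((\<lambda>z. \<psi> z * exp (- D * z)) has_field_derivative 0) (at z)" for z
    by (rule derivative_eq_intros d refl)+ (simp add: ode)
  then have "\<exists>c. \<forall>z\<in>UNIV. \<psi> z * exp (- D * z) = c"
    by (intro has_field_derivative_zero_constant) auto
  then obtain C where "\<And>z. \<psi> z * exp (- D * z) = C" by auto
  then have "\<psi> z = C * exp (D * z)" for z
    by (metis (no_types, opaque_lifting) exp_minus_inverse mult.assoc mult.commute mult.right_neutral mult_minus_left)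
  moreover have "D * (1 - cnj A) = \<beta>"
  proof -
    have "deriv \<psi> 0 / \<psi> 0 = D" using ode[of 0] \<psi>_zero_free[of 0] by simp
    moreover have "D * cnj A = deriv \<psi> 0 / \<psi> 0 - \<beta>" using False by (simp add: D_def)
    ultimately have "D * cnj A = D - \<beta>" by simp
    then show ?thesis by (simp add: algebra_simps)
  qed
  ultimately show ?thesis unfolding \<beta>_def by blast
qed

lemma exponent_le:
  assumes \<phi>: "\<And>z. \<phi> z = A * z + B" and \<psi>: "\<And>z. \<psi> z = C * exp (D * z)"
  shows "cmod D \<le> cmod B"
proof -
  have C: "C \<noteq> 0" using \<psi>_zero_free[of 0] \<psi>[of 0] by simp
  have "exp (Re (D * cnj D)) \<le> exp (((cmod B)\<^sup>2 + (cmod D)\<^sup>2) / 2)"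
    \<comment> \<open>The point \<open>cnj D\<close> maximises
      \<open>Re (D * z) - (cmod z)\<^sup>2 / 2\<close>, so it gives the sharpest instance with
      \<open>w = 0\<close>.\<close>
    using kernel_inequality[of "cnj D" 0] C by (simp add: \<phi> \<psi> norm_mult del: times_complex.sel)
  moreover have "Re (D * cnj D) = (cmod D)\<^sup>2"
    unfolding cmod_power2 by (simp add: power2_eq_square)
  ultimately have "(cmod D)\<^sup>2 \<le> (cmod B)\<^sup>2" by (simp del: times_complex.sel)
  then show ?thesis by (rule power2_le_imp_le) simp
qed

lemma W_maximal:
  assumes \<phi>: "\<And>z. \<phi> z = A * z + B" and \<psi>: "\<And>z. \<psi> z = C * exp (D * z)"
    and rel: "D * (1 - cnj A) = cnj B * (1 - A)"
  shows "W = weighted_comp_max \<psi> \<phi>"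
proof -
  have C: "C \<noteq> 0" using \<psi>_zero_free[of 0] \<psi>[of 0] by simp
  have \<psi>\<phi>: "\<psi> = (\<lambda>z. C * exp (D * z))" "\<phi> = (\<lambda>z. A * z + B)" using \<phi> \<psi> by auto
  have wc: "weighted_comp \<psi> \<phi> f = affine_comp A B C D f" for f
    unfolding \<psi>\<phi> by (rule weighted_comp_affine)
  have "f \<in> dom W" if "f \<in> dom (weighted_comp_max \<psi> \<phi>)" for f
  proof -
    have f: "f \<in> fock_space" "affine_comp A B C D f \<in> fock_space"
      using that by (auto simp: dom_weighted_comp_max wc)
    let ?H = "affine_comp (cnj A) (cnj D) (cnj C) (cnj B) f"
    have H: "?H \<in> fock_space" using affine_comp_adjoint_in_fock_space_iff[OF f(1) rel] f(2) by blast
    have "adjoint_rel W f ?H"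
      unfolding adjoint_rel_def
    proof (intro conjI ballI f(1) H)
      fix g assume "g \<in> dom W"
      \<comment> \<open>Elements of \<open>dom W\<close> lie in the maximal domain, so the adjoint
        identity holds for them whatever subspace \<open>dom W\<close> is.\<close>
      note g = weighted_comp_op_domD[OF W this, unfolded wc]
      show "fock_inner (the (W g)) f = fock_inner g ?H"
        using affine_comp_adjoint[OF f(1) g(1) C H g(2)] g(3) by simp
    qed
    then show ?thesis by (rule dom_adjointD(1))
  qed
  moreover have "W f = weighted_comp_max \<psi> \<phi> f" if "f \<in> dom W" for f
    using weighted_comp_op_domD[OF W that] by (simp add: weighted_comp_max_def)
  ultimately show ?thesis by (metis domIff ext)
qed

end

theorem theorem6p6:
  fixes \<psi> \<phi> :: "complex \<Rightarrow> complex" and W :: fock_op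
  assumes "\<psi> holomorphic_on UNIV" and "\<phi> holomorphic_on UNIV"
    and "\<exists>z. \<psi> z \<noteq> 0"
    and "is_weighted_comp_op \<psi> \<phi> W"
  shows "cohyponormal W \<longleftrightarrow>
    W = weighted_comp_max \<psi> \<phi> \<and>
    (\<exists>A B C D.
       ((\<forall>z. \<phi> z = A * z + B) \<and> A \<noteq> 1 \<and> (\<forall>z. \<psi> z = C * exp (D * z)) \<and>
          D = cnj B * (1 - A) * inverse (1 - cnj A)) \<or>
       ((\<forall>z. \<phi> z = z + B) \<and> (\<forall>z. \<psi> z = C * exp (D * z)) \<and> cmod B \<ge> cmod D))"
  (is "_ \<longleftrightarrow> _ \<and> (\<exists>A B C D. ?P A B C D \<or> ?Q A B C D)")
proof
  assume "cohyponormal W"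
  then interpret cohyponormal_weighted_comp \<psi> \<phi> W
    using assms by unfold_locales
  obtain A B where \<phi>: "\<And>z. \<phi> z = A * z + B" using \<phi>_affine by blast
  obtain C D where \<psi>: "\<And>z. \<psi> z = C * exp (D * z)" and rel: "D * (1 - cnj A) = cnj B * (1 - A)"
    using \<psi>_exponential[OF \<phi>] by blast
  have "?P A B C D \<or> ?Q A B C D"
  proof (cases "A = 1")
    case True
    \<comment> \<open>For \<open>A = 1\<close> the relation reads \<open>0 = 0\<close>, and
      \<open>exponent_le\<close> provides the condition of the second case.\<close>
    then show ?thesis using \<phi> \<psi> exponent_le[OF \<phi> \<psi>] by simp
  next
    case False
    then have "1 - cnj A \<noteq> 0" by (metis complex_cnj_cancel_iff complex_cnj_one eq_iff_diff_eq_0)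
    then have "D = cnj B * (1 - A) * inverse (1 - cnj A)"
      unfolding rel[symmetric] by simp
    then show ?thesis using \<phi> \<psi> False by blast
  qed
  then show "W = weighted_comp_max \<psi> \<phi> \<and> (\<exists>A B C D. ?P A B C D \<or> ?Q A B C D)"
    using W_maximal[OF \<phi> \<psi> rel] by blast
next
  assume R: "W = weighted_comp_max \<psi> \<phi> \<and> (\<exists>A B C D. ?P A B C D \<or> ?Q A B C D)"
  have "\<exists>A B C D. (\<forall>z. \<phi> z = A * z + B) \<and> (\<forall>z. \<psi> z = C * exp (D * z)) \<and>
      D * (1 - cnj A) = cnj B * (1 - A) \<and> cmod D \<le> cmod B"
  proof -
    from R obtain A B C D where "?P A B C D \<or> ?Q A B C D" by blast
    then show ?thesis
    proof
      assume P: "?P A B C D"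
      then have ne: "1 - cnj A \<noteq> 0" by (metis complex_cnj_cancel_iff complex_cnj_one eq_iff_diff_eq_0)
      then have rel: "D * (1 - cnj A) = cnj B * (1 - A)" using P by simp
      \<comment> \<open>Taking moduli in the relation gives \<open>cmod D = cmod B\<close>, so the
        inequality required for sufficiency is automatic in the first case.\<close>
      have "cmod (1 - A) = cmod (1 - cnj A)" using complex_mod_cnj[of "1 - A"] by simp
      then have "cmod D = cmod B"
        using arg_cong[OF rel, of cmod] ne by (simp add: norm_mult)
      then show ?thesis using P rel by (intro exI[of _ A] exI[of _ B] exI[of _ C] exI[of _ D]) simp
    next
      assume "?Q A B C D"
      then show ?thesis by (intro exI[of _ 1] exI[of _ B] exI[of _ C] exI[of _ D]) simp
    qed
  qed
  then obtain A B C D where "\<phi> = (\<lambda>z. A * z + B)" "\<psi> = (\<lambda>z. C * exp (D * z))"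
    and "D * (1 - cnj A) = cnj B * (1 - A)" "cmod D \<le> cmod B"
    by blast
  then show "cohyponormal W"
    using R cohyponormal_affine_comp by simp
qed

end
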